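(* For every integer $d \geq 3$ the set $$\mathcal{D}_d := \Big\{\dim_H(\operatorname{supp}(\mu)) :\ \mu \in \mathcal{P}_d^{\lambda_{d-1}}\Big\}$$ is dense in $[d-1,d]$.
   Context: $\lambda_k$ denotes Lebesgue measure on $[0,1]^k$. A Borel probability measure $\mu$ on $[0,1]^d$ is called $d$-stochastic if for every $j\in\{1,\ldots,d\}$ its push-forward under the coordinate projection $\mathbf{x}\mapsto x_j$ is $\lambda_1$. For $j_0 \in \{1,\ldots,d\}$ let $\pi_{-j_0}:[0,1]^d\to[0,1]^{d-1}$ be the projection $(x_1,\ldots,x_d)\mapsto (x_1,\ldots,x_{j_0-1},x_{j_0+1},\ldots,x_d)$. $\mathcal{P}_d^{\lambda_{d-1}}$ denotes the family of all $d$-stochastic measures $\mu$ such that for every $j_0\in\{1,\ldots,d\}$ the push-forward $\mu^{\pi_{-j_0}}$ of $\mu$ under $\pi_{-j_0}$ equals $\lambda_{d-1}$. $\operatorname{supp}(\mu)$ is the (closed) support of $\mu$ and $\dim_H$ is the Hausdorff dimension with respect to the Euclidean metric. *)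

theory Defs
  imports "HOL-Probability.Probability"
begin

text \<open>
  The convention is \<open>0 ^ 0 = 1\<close> on nonempty sets, so that the 0-dimensional Hausdorff measure
  counts points; the case distinction is needed because \<open>0 powr 0 = 0\<close> in the library.
\<close>

definition diam_pow :: "real \<Rightarrow> 'a::metric_space set \<Rightarrow> ennreal" where
  "diam_pow s U = (if U = {} then 0 else if s = 0 then 1 else ennreal (diameter U powr s))"

text \<open>
  Boundedness is demanded separately because the value of \<open>diameter\<close> at an unbounded set is
  unspecified.
\<close>

definition hausdorff_premeasure :: "real \<Rightarrow> real \<Rightarrow> 'a::metric_space set \<Rightarrow> ennreal" where
  "hausdorff_premeasure \<delta> s A =
     (INF U \<in> {U :: nat \<Rightarrow> 'a set. A \<subseteq> (\<Union>i. U i) \<and> (\<forall>i. bounded (U i) \<and> diameter (U i) \<le> \<delta>)}.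
        \<Sum>i. diam_pow s (U i))"

definition hausdorff_measure :: "real \<Rightarrow> 'a::metric_space set \<Rightarrow> ennreal" where
  "hausdorff_measure s A = (SUP \<delta> \<in> {0<..}. hausdorff_premeasure \<delta> s A)"

definition hausdorff_dim :: "'a::metric_space set \<Rightarrow> ereal" where
  "hausdorff_dim A = (INF s \<in> {s :: real. 0 \<le> s \<and> hausdorff_measure s A = 0}. ereal s)"

text \<open>
  The support is taken in the subspace \<open>space \<mu>\<close>, whose open sets are the traces
  \<open>U \<inter> space \<mu>\<close> of open sets \<open>U\<close>.
\<close>

definition supp :: "'a::topological_space measure \<Rightarrow> 'a set" where
  "supp \<mu> = {x \<in> space \<mu>. \<forall>U. open U \<longrightarrow> x \<in> U \<longrightarrow> emeasure \<mu> (U \<inter> space \<mu>) > 0}"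

text \<open>
  The dimension \<open>d\<close> is \<open>CARD('n)\<close>, and \<open>real ^ 'n\<close> carries the Euclidean metric.
  A \<open>k\<close>-dimensional cube whose coordinates are indexed by a \<open>k\<close>-element set \<open>I\<close> is represented
  by the extensional functions on \<open>I\<close>, so that \<open>lebesgue_cube I\<close> is (Borel) Lebesgue
  measure \<open>\<lambda>\<^sub>k\<close> on it.
\<close>

definition lebesgue_unit :: "real measure" where
  "lebesgue_unit = restrict_space lborel {0..1}"

definition lebesgue_cube :: "'i set \<Rightarrow> ('i \<Rightarrow> real) measure" where
  "lebesgue_cube I = PiM I (\<lambda>_. lebesgue_unit)"

definition borel_cube :: "(real ^ 'n) measure" where
  "borel_cube = restrict_space borel (cbox 0 1)"

definition drop_coord :: "'n \<Rightarrow> real ^ 'n \<Rightarrow> 'n \<Rightarrow> real" where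
  "drop_coord j x = restrict (\<lambda>i. x $ i) (UNIV - {j})"

definition stochastic_measure :: "(real ^ 'n) measure \<Rightarrow> bool" where
  "stochastic_measure \<mu> \<longleftrightarrow>
     prob_space \<mu> \<and> sets \<mu> = sets borel_cube \<and>
     (\<forall>j. distr \<mu> lebesgue_unit (\<lambda>x. x $ j) = lebesgue_unit)"

definition stochastic_uniform_marginals :: "(real ^ 'n) measure set" where
  "stochastic_uniform_marginals =
     {\<mu>. stochastic_measure \<mu> \<and>
         (\<forall>j. distr \<mu> (lebesgue_cube (UNIV - {j})) (drop_coord j) = lebesgue_cube (UNIV - {j}))}"

definition support_dims :: "'n::finite itself \<Rightarrow> ereal set" where
  "support_dims _ =
     {hausdorff_dim (supp \<mu>) | \<mu> :: (real ^ 'n) measure. \<mu> \<in> stochastic_uniform_marginals}"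

text \<open>
  The maps used in the push-forwards above are measurable, so \<open>distr\<close> is the genuine push-forward.
\<close>

lemma coord_measurable:
  assumes "sets \<mu> = sets (borel_cube :: (real ^ 'n) measure)"
  shows "(\<lambda>x. x $ j) \<in> measurable \<mu> lebesgue_unit"
proof -
  have "(\<lambda>x :: real ^ 'n. x $ j) \<in> measurable borel_cube lebesgue_unit"
    unfolding borel_cube_def lebesgue_unit_def
    by (rule measurable_restrict_space2)
      (auto simp: space_restrict_space mem_box_cart intro!: measurable_restrict_space1
        borel_measurable_continuous_onI continuous_intros)
  then show ?thesis
    by (simp add: measurable_cong_sets[OF assms refl])
qed

lemma drop_coord_measurable:
  assumes "sets \<mu> = sets (borel_cube :: (real ^ 'n) measure)"
  shows "drop_coord j \<in> measurable \<mu> (lebesgue_cube (UNIV - {j}))"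
  unfolding drop_coord_def[abs_def] lebesgue_cube_def
  by (rule measurable_restrict) (rule coord_measurable[OF assms])

end

theory Submission
  imports Defs
begin

text \<open>
  Let \<open>d\<close> be the number of coordinates.

  The dimension of every support lies between \<open>d - 1\<close> and \<open>d\<close>: the support is a subset of the cube,
  and its measure has a uniform \<open>(d - 1)\<close>-dimensional marginal, so that a ball of radius \<open>r\<close> has mass
  at most \<open>(2 r)\<^sup>d\<^sup>-\<^sup>1\<close> and the mass distribution principle applies (\<open>dim_supp_ge\<close>, \<open>dim_supp_le\<close>).

  For the density, let all coordinates but one be independent and uniform, let \<open>Z\<close> be independent of
  them with an arbitrary law on the unit interval, and let the last coordinate be \<open>Z\<close> minus the
  sum of the others, modulo \<open>1\<close>. Given \<open>Z\<close>, rotation invariance of the uniform distribution on the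
  circle makes any \<open>d - 1\<close> coordinates independent and uniform. Hence every law of \<open>Z\<close> yields a
  measure with uniform marginals (\<open>twisted_measure_uniform_marginals\<close>), and this measure lives on
  the points whose coordinate sum is, modulo \<open>1\<close>, a value of \<open>Z\<close>. Locally, this set is a product of a
  \<open>(d - 1)\<close>-dimensional cube and the range of \<open>Z\<close>, so that its dimension should be \<open>d - 1 + t\<close> if \<open>t\<close>
  is the dimension of that range. Both inequalities hold if the law of \<open>Z\<close> is a Frostman measure with
  exponent \<open>t\<close> and the range of \<open>Z\<close> can be covered by about \<open>\<epsilon> powr -t\<close> intervals of length \<open>\<epsilon>\<close>
  (\<open>dim_supp_twisted_measure_ge\<close>, \<open>dim_supp_twisted_measure_le\<close>).

  A suitable \<open>Z\<close> is a uniformly distributed point of a self-similar Cantor set with digits below \<open>m\<close>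
  in base \<open>N\<close>, obtained from a uniform variable by reading its digits in base \<open>m\<close> as digits
  in base \<open>N\<close>. It has \<open>t = log N m\<close> (\<open>dim_supp_twisted_spread\<close>), and powers of \<open>2\<close> for \<open>m\<close> and \<open>N\<close> give all
  fractions strictly between \<open>0\<close> and \<open>1\<close>.
\<close>

section \<open>Bounds for Hausdorff dimension\<close>

text \<open>
  The lower bounds come from measures that give little mass to small balls, the upper bounds from
  explicit covers.
\<close>

lemma hausdorff_dim_geI:
  assumes "\<And>s'. 0 \<le> s' \<Longrightarrow> s' < s \<Longrightarrow> hausdorff_measure s' A \<noteq> 0"
  shows "ereal s \<le> hausdorff_dim A"
  unfolding hausdorff_dim_def
proof (rule INF_greatest)
  fix s' assume "s' \<in> {s. 0 \<le> s \<and> hausdorff_measure s A = 0}"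
  with assms[of s'] show "ereal s \<le> ereal s'"
    by (cases "s' < s") auto
qed

lemma complement_supp_null:
  fixes \<mu> :: "'a::second_countable_topology measure"
  assumes sets: "sets \<mu> = sets (restrict_space borel S)"
  shows "\<exists>Z\<in>null_sets \<mu>. space \<mu> - supp \<mu> \<subseteq> Z"
proof -
  obtain B :: "'a set set" where B: "countable B" "topological_basis B"
    using ex_countable_basis by blast
  define Z where "Z = (\<Union>U\<in>{U\<in>B. emeasure \<mu> (U \<inter> space \<mu>) = 0}. U \<inter> space \<mu>)"
  have space: "space \<mu> = S"
    using sets_eq_imp_space_eq[OF sets] by (simp add: space_restrict_space)
  have "Z \<in> null_sets \<mu>"
    unfolding Z_def
  proof (rule null_sets_UN')
    show "countable {U \<in> B. emeasure \<mu> (U \<inter> space \<mu>) = 0}"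
      using B(1) by (rule countable_subset[rotated]) auto
    fix U assume U: "U \<in> {U \<in> B. emeasure \<mu> (U \<inter> space \<mu>) = 0}"
    then have "open U" using B(2) topological_basis_open by auto
    then have "U \<inter> space \<mu> \<in> sets \<mu>"
      unfolding sets space by (auto simp: sets_restrict_space)
    then show "U \<inter> space \<mu> \<in> null_sets \<mu>" using U by auto
  qed
  moreover have "space \<mu> - supp \<mu> \<subseteq> Z"
  proof
    fix x assume x: "x \<in> space \<mu> - supp \<mu>"
    then obtain U where U: "open U" "x \<in> U" "emeasure \<mu> (U \<inter> space \<mu>) = 0"
      unfolding supp_def by (auto simp: not_gr_zero)
    then obtain V where V: "V \<in> B" "x \<in> V" "V \<subseteq> U"
      using topological_basisE[OF B(2)] by metis
    have "U \<inter> space \<mu> \<in> sets \<mu>"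
      unfolding sets space using U(1) by (auto simp: sets_restrict_space)
    then have "emeasure \<mu> (V \<inter> space \<mu>) \<le> emeasure \<mu> (U \<inter> space \<mu>)"
      using V(3) by (intro emeasure_mono) auto
    with U(3) V x show "x \<in> Z" unfolding Z_def by auto
  qed
  ultimately show ?thesis by blast
qed

lemma supp_subset_closed:
  assumes "closed K" "emeasure \<mu> (space \<mu> - K) = 0"
  shows "supp \<mu> \<subseteq> K"
proof
  fix x assume x: "x \<in> supp \<mu>"
  show "x \<in> K"
  proof (rule ccontr)
    assume "x \<notin> K"
    then have "emeasure \<mu> ((- K) \<inter> space \<mu>) > 0"
      using x assms(1) unfolding supp_def by auto
    moreover have "(- K) \<inter> space \<mu> = space \<mu> - K" by auto
    ultimately show False using assms(2) by simp
  qed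
qed

text \<open>
  Frostman's mass distribution principle. A set of diameter \<open>r\<close> lies in a closed ball of radius
  \<open>r\<close> and so carries mass at most \<open>C r\<^sup>s\<close>; since the support carries all the mass, the sum of
  \<open>r\<^sup>s\<close> over any cover of it is at least \<open>1 / C\<close>.
\<close>

lemma mass_distribution_principle:
  fixes \<mu> :: "'a::{metric_space, second_countable_topology} measure"
  assumes "prob_space \<mu>" and sets: "sets \<mu> = sets (restrict_space borel S)"
    and s: "0 < s" and C: "0 < C"
    and ball: "\<And>x r. 0 < r \<Longrightarrow> emeasure \<mu> (cball x r \<inter> space \<mu>) \<le> ennreal (C * r powr s)"
  shows "ereal s \<le> hausdorff_dim (supp \<mu>)"
proof (rule hausdorff_dim_geI)
  fix s' :: real assume s': "0 \<le> s'" "s' < s"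
  interpret prob_space \<mu> by fact
  have space: "space \<mu> = S"
    using sets_eq_imp_space_eq[OF sets] by (simp add: space_restrict_space)
  have cball_sets: "cball x r \<inter> space \<mu> \<in> sets \<mu>" for x r
    unfolding sets space by (auto simp: sets_restrict_space)
  \<comment> \<open>the radius \<open>0\<close> is needed for the one-point sets of a cover; the measure has no atoms\<close>
  have ball0: "emeasure \<mu> (cball x r \<inter> space \<mu>) \<le> ennreal (C * r powr s)" if "0 \<le> r" for x r
  proof (cases "r = 0")
    case True
    have "((\<lambda>r. C * r powr s) \<longlongrightarrow> C * 0) (at_right 0)"
      using s eventually_at_right_less[of "0::real"]
      by (intro tendsto_intros tendsto_zero_powrI[where b = s])
        (auto elim: eventually_mono intro!: tendsto_eq_intros)
    then have "((\<lambda>r. ennreal (C * r powr s)) \<longlongrightarrow> ennreal 0) (at_right 0)"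
      by (intro tendsto_ennrealI) simp
    moreover have "emeasure \<mu> (cball x r \<inter> space \<mu>) \<le> ennreal (C * r' powr s)" if "0 < r'" for r'
      by (rule order_trans[OF emeasure_mono ball[OF that, of x]])
        (use True that cball_sets in auto)
    ultimately have "emeasure \<mu> (cball x r \<inter> space \<mu>) \<le> ennreal 0"
      by (intro tendsto_lowerbound[where F = "at_right (0::real)"])
        (auto simp: eventually_at_filter)
    then show ?thesis using True by simp
  qed (use ball that in auto)
  have small: "\<exists>V\<in>sets \<mu>. U \<inter> space \<mu> \<subseteq> V \<and> emeasure \<mu> V \<le> ennreal C * diam_pow s' U"
    if U: "bounded U" "diameter U \<le> 1" for U :: "'a set"
  proof (cases "U = {}")
    case True
    then show ?thesis by (intro bexI[of _ "{}"]) auto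
  next
    case False
    then obtain x where x: "x \<in> U" by blast
    let ?r = "diameter U"
    have r: "0 \<le> ?r" using U(1) diameter_ge_0 by blast
    have sub: "U \<subseteq> cball x ?r"
      using diameter_bounded_bound[OF U(1) x] by auto
    have "?r powr s \<le> ?r powr s'" using r U(2) s' by (intro powr_mono') auto
    moreover have "?r powr s \<le> 1" using r U(2) s by (simp add: powr_le1)
    ultimately have "ennreal (C * ?r powr s) \<le> ennreal C * diam_pow s' U"
      using False C unfolding diam_pow_def
      by (auto simp flip: ennreal_mult intro!: ennreal_leI)
    then have "emeasure \<mu> (cball x ?r \<inter> space \<mu>) \<le> ennreal C * diam_pow s' U"
      using ball0[OF r, of x] by (rule order_trans[rotated])
    with sub cball_sets show ?thesis by blast
  qed
  obtain Z where Z: "Z \<in> null_sets \<mu>" "space \<mu> - supp \<mu> \<subseteq> Z"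
    using complement_supp_null[OF sets] by blast
  have cover: "ennreal (1 / C) \<le> (\<Sum>i. diam_pow s' (U i))"
    if U: "supp \<mu> \<subseteq> (\<Union>i. U i)" "\<And>i. bounded (U i)" "\<And>i. diameter (U i) \<le> 1"
    for U :: "nat \<Rightarrow> 'a set"
  proof -
    obtain V where V: "\<And>i. V i \<in> sets \<mu>" "\<And>i. U i \<inter> space \<mu> \<subseteq> V i"
      "\<And>i. emeasure \<mu> (V i) \<le> ennreal C * diam_pow s' (U i)"
      using small[OF U(2,3)] by metis
    have "1 = emeasure \<mu> (space \<mu>)" by (simp add: emeasure_space_1)
    also have "\<dots> \<le> emeasure \<mu> ((\<Union>i. V i) \<union> Z)"
      using Z U(1) V(1,2) by (intro emeasure_mono) (auto, blast)
    also have "\<dots> = emeasure \<mu> (\<Union>i. V i)"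
      using V(1) Z(1) by (intro emeasure_Un_null_set) auto
    also have "\<dots> \<le> (\<Sum>i. emeasure \<mu> (V i))"
      using V(1) by (intro emeasure_subadditive_countably) auto
    also have "\<dots> \<le> (\<Sum>i. ennreal C * diam_pow s' (U i))"
      using V(3) by (intro suminf_le) auto
    also have "\<dots> = ennreal C * (\<Sum>i. diam_pow s' (U i))" by simp
    finally have "ennreal (1 / C) * 1 \<le> ennreal (1 / C) * (ennreal C * (\<Sum>i. diam_pow s' (U i)))"
      by (rule mult_left_mono) simp
    also have "\<dots> = (\<Sum>i. diam_pow s' (U i))"
      using C by (simp flip: mult.assoc ennreal_mult)
    finally show ?thesis by simp
  qed
  have "0 < ennreal (1 / C)" using C by simp
  also have "\<dots> \<le> hausdorff_premeasure 1 s' (supp \<mu>)"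
    unfolding hausdorff_premeasure_def by (rule INF_greatest) (use cover in auto)
  also have "\<dots> \<le> hausdorff_measure s' (supp \<mu>)"
    unfolding hausdorff_measure_def by (rule SUP_upper) simp
  finally show "hausdorff_measure s' (supp \<mu>) \<noteq> 0" by simp
qed

lemma hausdorff_premeasure_le_finite_cover:
  assumes "finite F" "A \<subseteq> \<Union>F" "0 < s"
    and F: "\<And>U. U \<in> F \<Longrightarrow> bounded U" "\<And>U. U \<in> F \<Longrightarrow> diameter U \<le> r"
    and "r \<le> \<delta>" "0 \<le> r"
  shows "hausdorff_premeasure \<delta> s A \<le> ennreal (real (card F) * r powr s)"
proof -
  obtain e where e: "bij_betw e {0..<card F} F"
    using ex_bij_betw_nat_finite[OF assms(1)] by blast
  define U where "U i = (if i < card F then e i else {})" for i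
  have UF: "U i \<in> F" if "i < card F" for i
    using e that unfolding U_def by (auto dest!: bij_betwE)
  have "A \<subseteq> (\<Union>i. U i)"
  proof
    fix x assume "x \<in> A"
    then obtain V where V: "V \<in> F" "x \<in> V" using assms(2) by blast
    then obtain i where "i < card F" "e i = V"
      using e unfolding bij_betw_def by (metis atLeastLessThan_iff imageE)
    then have "x \<in> U i" using V(2) by (simp add: U_def)
    then show "x \<in> (\<Union>i. U i)" by blast
  qed
  moreover have "bounded (U i) \<and> diameter (U i) \<le> \<delta>" for i
  proof (cases "i < card F")
    case True
    then show ?thesis using F[OF UF[OF True]] assms(6) by auto
  qed (use assms in \<open>auto simp: U_def\<close>)
  ultimately have "hausdorff_premeasure \<delta> s A \<le> (\<Sum>i. diam_pow s (U i))"
    unfolding hausdorff_premeasure_def by (intro INF_lower) auto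
  also have "\<dots> = (\<Sum>i<card F. diam_pow s (U i))"
    by (rule suminf_finite) (auto simp: U_def diam_pow_def)
  also have "\<dots> \<le> (\<Sum>i<card F. ennreal (r powr s))"
  proof (rule sum_mono)
    fix i assume "i \<in> {..<card F}"
    then have "bounded (U i)" "diameter (U i) \<le> r" using F UF by auto
    then show "diam_pow s (U i) \<le> ennreal (r powr s)"
      using assms(3) unfolding diam_pow_def
      by (auto intro!: ennreal_leI powr_mono2 diameter_ge_0)
  qed
  also have "\<dots> = ennreal (real (card F) * r powr s)"
    by (simp add: ennreal_of_nat_eq_real_of_nat ennreal_mult)
  finally show ?thesis .
qed

text \<open>
  The upper bound by box counting: for \<open>s > u\<close> the sum of the \<open>s\<close>-th powers of the diameters in the
  \<open>k\<close>-th cover is at most a constant times \<open>b powr (k (u - s))\<close>, which tends to \<open>0\<close>.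
\<close>

lemma hausdorff_dim_le_box_counting:
  fixes A :: "'a::metric_space set"
  assumes b: "1 < b" and C: "0 \<le> C" and D: "0 \<le> D" and u: "0 \<le> u"
    and cover: "\<And>k::nat. \<exists>F. finite F \<and> A \<subseteq> \<Union>F \<and> real (card F) \<le> C * (b ^ k) powr u \<and>
       (\<forall>U\<in>F. bounded U \<and> diameter U \<le> D / b ^ k)"
  shows "hausdorff_dim A \<le> ereal u"
proof (rule ereal_le_epsilon2)
  have "hausdorff_dim A \<le> ereal s" if s: "u < s" for s
  proof -
    have s0: "0 < s" using u s by simp
    have "hausdorff_premeasure \<delta> s A \<le> 0" if \<delta>: "0 < \<delta>" for \<delta>
    proof (rule tendsto_lowerbound)
      have inv: "(\<lambda>k. inverse b ^ k) \<longlonglongrightarrow> 0"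
        using b by (intro LIMSEQ_realpow_zero) (auto simp: field_simps)
      have "(\<lambda>k. (C * D powr s) * (inverse b ^ k) powr (s - u)) \<longlonglongrightarrow> (C * D powr s) * 0"
        using s b by (intro tendsto_mult tendsto_const tendsto_zero_powrI[OF inv tendsto_const]) auto
      then show "(\<lambda>k. ennreal ((C * D powr s) * (inverse b ^ k) powr (s - u))) \<longlonglongrightarrow> 0"
        by (metis ennreal_0 mult_zero_right tendsto_ennrealI)
      have "(\<lambda>k. D * inverse b ^ k) \<longlonglongrightarrow> D * 0"
        by (intro tendsto_intros inv)
      then have "\<forall>\<^sub>F k in sequentially. D * inverse b ^ k < \<delta>"
        using \<delta> by (auto dest!: order_tendstoD(2))
      then show "\<forall>\<^sub>F k in sequentially.
          hausdorff_premeasure \<delta> s A \<le> ennreal ((C * D powr s) * (inverse b ^ k) powr (s - u))"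
      proof eventually_elim
        case (elim k)
        obtain F where F: "finite F" "A \<subseteq> \<Union>F" "real (card F) \<le> C * (b ^ k) powr u"
          "\<And>U. U \<in> F \<Longrightarrow> bounded U" "\<And>U. U \<in> F \<Longrightarrow> diameter U \<le> D / b ^ k"
          using cover[of k] by blast
        have bk: "0 < b ^ k" using b by simp
        have "hausdorff_premeasure \<delta> s A \<le> ennreal (real (card F) * (D / b ^ k) powr s)"
          using elim D b
          by (intro hausdorff_premeasure_le_finite_cover[OF F(1,2) s0 F(4,5)])
            (auto simp: field_simps)
        also have "\<dots> \<le> ennreal ((C * (b ^ k) powr u) * (D / b ^ k) powr s)"
          using F(3) by (intro ennreal_leI mult_right_mono) auto
        also have "(C * (b ^ k) powr u) * (D / b ^ k) powr s =
            (C * D powr s) * (inverse b ^ k) powr (s - u)"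
          using bk D by (simp add: powr_divide powr_diff power_inverse inverse_eq_divide field_simps)
        finally show ?case .
      qed
    qed simp
    then have "hausdorff_measure s A = 0"
      unfolding hausdorff_measure_def by (auto simp: SUP_eq_const intro!: antisym SUP_least)
    then show ?thesis
      unfolding hausdorff_dim_def using s0 by (intro INF_lower) auto
  qed
  then show "hausdorff_dim A \<le> ereal u + ereal e" if "0 < e" for e :: real
    using that by auto
qed

text \<open>
  A set whose coordinate sums fill only a small part of the line is thin: fixing all coordinates
  but one and the sum up to an error \<open>1 / M\<close> fixes the remaining coordinate up to \<open>d / M\<close>.
  The case \<open>t = 1\<close>, where an equidistant grid serves as \<open>F\<close>, bounds the dimension of every subset of
  the cube by \<open>d\<close>.
\<close>

lemma hausdorff_dim_le_coordinate_sum: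
  fixes A :: "(real ^ 'n::finite) set"
  assumes A: "A \<subseteq> cbox 0 1" and N: "2 \<le> N" and t: "0 \<le> t" and C: "0 \<le> C"
    and sums: "\<And>k::nat. \<exists>F. finite F \<and> real (card F) \<le> C * (real N ^ k) powr t \<and>
      (\<forall>x\<in>A. \<exists>a\<in>F. (\<Sum>i\<in>UNIV. x $ i) \<in> {a..a + 1 / real N ^ k})"
  shows "hausdorff_dim A \<le> ereal (real CARD('n) - 1 + t)"
proof (rule hausdorff_dim_le_box_counting)
  let ?d = "CARD('n)"
  show "1 < real N" "0 \<le> 2 ^ (?d - 1) * C" "0 \<le> (real ?d)\<^sup>2" using N C by auto
  have d: "1 \<le> ?d" by (simp add: Suc_leI)
  then show "0 \<le> real ?d - 1 + t" using t by simp
  fix k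
  define M where "M = N ^ k"
  have M: "0 < M" "real M = real N ^ k" using N by (auto simp: M_def)
  obtain F where F: "finite F" "real (card F) \<le> C * (real N ^ k) powr t"
      "\<And>x. x \<in> A \<Longrightarrow> \<exists>a\<in>F. (\<Sum>i\<in>UNIV. x $ i) \<in> {a..a + 1 / real N ^ k}"
    using sums[of k] by blast
  define j :: 'n where "j = undefined"
  define I where "I = PiE (UNIV - {j}) (\<lambda>_. {..M})"
  define box :: "('n \<Rightarrow> nat) \<Rightarrow> real \<Rightarrow> (real ^ 'n) set"
    where "box f a = {x. (\<forall>i\<in>UNIV - {j}. x $ i \<in> {f i / M..(f i + 1) / M}) \<and>
        (\<Sum>i\<in>UNIV. x $ i) \<in> {a..a + 1 / M}}" for f a
  define \<F> where "\<F> = (\<lambda>(f, a). box f a) ` (I \<times> F)"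
  have finI: "finite I" unfolding I_def by (intro finite_PiE) auto
  have "real (card \<F>) \<le> real (card I) * real (card F)"
    unfolding \<F>_def using card_image_le[of "I \<times> F" "\<lambda>(f, a). box f a"] finI F(1)
    by (simp add: card_cartesian_product flip: of_nat_mult)
  also have "card I = (M + 1) ^ (?d - 1)"
    unfolding I_def by (subst card_PiE) (auto simp: card_Diff_subset)
  also have "real \<dots> \<le> real ((2 * M) ^ (?d - 1))"
    using M by (intro of_nat_mono power_mono) auto
  also have "\<dots> = 2 ^ (?d - 1) * (real N ^ k) powr (real ?d - 1)"
    using M d by (simp add: power_mult_distrib powr_realpow[symmetric] of_nat_diff)
  finally have "real (card \<F>) \<le>
      (2 ^ (?d - 1) * (real N ^ k) powr (real ?d - 1)) * (C * (real N ^ k) powr t)"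
    by (rule order_trans[OF _ mult_left_mono[OF F(2)]]) (auto intro: mult_right_mono)
  also have "\<dots> = 2 ^ (?d - 1) * C * (real N ^ k) powr (real ?d - 1 + t)"
    by (simp add: powr_add)
  finally have card: "real (card \<F>) \<le> 2 ^ (?d - 1) * C * (real N ^ k) powr (real ?d - 1 + t)" .
  have "A \<subseteq> \<Union>\<F>"
  proof
    fix x assume x: "x \<in> A"
    then obtain a where a: "a \<in> F" "(\<Sum>i\<in>UNIV. x $ i) \<in> {a..a + 1 / M}"
      using F(3) M(2) by metis
    have x01: "0 \<le> x $ i" "x $ i \<le> 1" for i using x A by (auto simp: mem_box_cart)
    define f where "f = restrict (\<lambda>i. nat \<lfloor>x $ i * M\<rfloor>) (UNIV - {j})"
    have fl: "real (nat \<lfloor>x $ i * M\<rfloor>) \<le> x $ i * M" "x $ i * M \<le> real (nat \<lfloor>x $ i * M\<rfloor>) + 1" for i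
      using x01[of i] M by (auto simp: of_nat_nat floor_le_iff)
    have "nat \<lfloor>x $ i * M\<rfloor> \<le> M" for i
    proof -
      have "real (nat \<lfloor>x $ i * M\<rfloor>) \<le> x $ i * M" by (rule fl)
      also have "\<dots> \<le> M" using x01[of i] by (simp add: mult_left_le_one_le)
      finally show ?thesis by simp
    qed
    then have "f \<in> I" by (auto simp: f_def I_def)
    moreover have "x \<in> box f a"
      using a(2) fl M(1) by (auto simp: box_def f_def field_simps)
    ultimately show "x \<in> \<Union>\<F>" using a(1) unfolding \<F>_def by auto
  qed
  moreover have "bounded U \<and> diameter U \<le> (real ?d)\<^sup>2 / real N ^ k" if "U \<in> \<F>" for U
  proof -
    from that obtain f a where U: "U = box f a" by (auto simp: \<F>_def)
    have dist: "dist x y \<le> (real ?d)\<^sup>2 / M" if xy: "x \<in> U" "y \<in> U" for x y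
    proof -
      have c1: "\<bar>x $ i - y $ i\<bar> \<le> 1 / M" if "i \<noteq> j" for i
      proof -
        have "x $ i \<in> {f i / M..f i / M + 1 / M}" "y $ i \<in> {f i / M..f i / M + 1 / M}"
          using xy that by (auto simp: U box_def add_divide_distrib)
        then show ?thesis by auto
      qed
      have c2: "\<bar>(\<Sum>i\<in>UNIV. x $ i) - (\<Sum>i\<in>UNIV. y $ i)\<bar> \<le> 1 / M"
        using xy by (auto simp: U box_def)
      have split: "(\<Sum>i\<in>UNIV. z $ i) = z $ j + (\<Sum>i\<in>UNIV - {j}. z $ i)" for z :: "real ^ 'n"
        by (simp add: sum.remove)
      have "\<bar>\<Sum>i\<in>UNIV - {j}. x $ i - y $ i\<bar> \<le> (\<Sum>i\<in>UNIV - {j}. 1 / M)"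
        using c1 by (intro order_trans[OF sum_abs] sum_mono) auto
      also have "\<dots> = (real ?d - 1) / M"
        using d by (simp add: card_Diff_subset of_nat_diff)
      finally have "\<bar>x $ j - y $ j\<bar> \<le> 1 / M + (real ?d - 1) / M"
        using c2 unfolding split by (simp add: sum_subtractf)
      then have cj: "\<bar>x $ j - y $ j\<bar> \<le> ?d / M"
        by (simp add: add_divide_distrib[symmetric])
      have "1 / M \<le> ?d / M" using d M by (simp add: field_simps)
      with c1 cj have all: "\<bar>x $ i - y $ i\<bar> \<le> ?d / M" for i by (metis order_trans)
      have "dist x y \<le> (\<Sum>i\<in>UNIV. \<bar>(x - y) $ i\<bar>)"
        unfolding dist_norm by (rule norm_le_l1_cart)
      also have "\<dots> \<le> (\<Sum>i\<in>(UNIV::'n set). ?d / M)"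
        using all by (intro sum_mono) auto
      also have "\<dots> = (real ?d)\<^sup>2 / M" by (simp add: power2_eq_square)
      finally show ?thesis .
    qed
    then have "bounded U" unfolding bounded_two_points by blast
    moreover have "diameter U \<le> (real ?d)\<^sup>2 / M"
      using dist M by (intro diameter_le) (auto simp: dist_norm)
    ultimately show ?thesis using M(2) by simp
  qed
  ultimately show "\<exists>F. finite F \<and> A \<subseteq> \<Union>F \<and>
      real (card F) \<le> 2 ^ (?d - 1) * C * (real N ^ k) powr (real ?d - 1 + t) \<and>
      (\<forall>U\<in>F. bounded U \<and> diameter U \<le> (real ?d)\<^sup>2 / real N ^ k)"
    using finI F(1) card by (intro exI[of _ \<F>]) (auto simp: \<F>_def)
qed

section \<open>The unit cube and the range of the dimensions\<close>

lemma space_lebesgue_unit [simp]: "space lebesgue_unit = {0..1}"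
  by (simp add: lebesgue_unit_def space_restrict_space)

lemma sets_lebesgue_unit: "sets lebesgue_unit = sets (restrict_space borel {0..1})"
  by (simp add: lebesgue_unit_def sets_restrict_space)

lemma Int_unit_in_sets [simp]: "A \<in> sets borel \<Longrightarrow> A \<inter> {0..1} \<in> sets lebesgue_unit"
  by (auto simp: sets_lebesgue_unit sets_restrict_space)

lemma emeasure_lebesgue_unit_Int:
  "A \<in> sets borel \<Longrightarrow> emeasure lebesgue_unit (A \<inter> {0..1}) = emeasure lborel (A \<inter> {0..1})"
  by (simp add: lebesgue_unit_def emeasure_restrict_space)

lemma borel_measurable_lebesgue_unit:
  "f \<in> borel_measurable borel \<Longrightarrow> f \<in> borel_measurable lebesgue_unit"
  unfolding lebesgue_unit_def by (intro measurable_restrict_space1) simp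

lemma space_borel_cube [simp]: "space borel_cube = cbox 0 1"
  by (simp add: borel_cube_def space_restrict_space)

lemma space_lebesgue_cube: "space (lebesgue_cube I) = PiE I (\<lambda>_. {0..1})"
  by (simp add: lebesgue_cube_def space_PiM)

interpretation unit: prob_space lebesgue_unit
proof
  have "emeasure lebesgue_unit (UNIV \<inter> {0..1}) = emeasure lborel (UNIV \<inter> {0..1::real})"
    by (rule emeasure_lebesgue_unit_Int) simp
  then show "emeasure lebesgue_unit (space lebesgue_unit) = 1" by simp
qed

interpretation cube: product_prob_space "\<lambda>_. lebesgue_unit" I for I :: "'i set"
  by unfold_locales

lemma emeasure_lebesgue_unit_interval_le:
  assumes "0 \<le> r"
  shows "emeasure lebesgue_unit ({a - r..a + r} \<inter> {0..1}) \<le> ennreal (2 * r)"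
proof -
  have "emeasure lebesgue_unit ({a - r..a + r} \<inter> {0..1}) \<le> emeasure lborel {a - r..a + r}"
    by (subst emeasure_lebesgue_unit_Int) (auto intro: emeasure_mono)
  then show ?thesis using assms by simp
qed

lemma emeasure_lebesgue_cube_box_le:
  assumes "finite I" "0 \<le> r"
  shows "emeasure (lebesgue_cube I) (PiE I (\<lambda>i. {x i - r..x i + r} \<inter> {0..1})) \<le>
    ennreal ((2 * r) ^ card I)"
proof -
  have "emeasure (lebesgue_cube I) (PiE I (\<lambda>i. {x i - r..x i + r} \<inter> {0..1})) =
      (\<Prod>i\<in>I. emeasure lebesgue_unit ({x i - r..x i + r} \<inter> {0..1}))"
    unfolding lebesgue_cube_def by (intro cube.emeasure_PiM[OF assms(1)] Int_unit_in_sets) simp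
  also have "\<dots> \<le> (\<Prod>i\<in>I. ennreal (2 * r))"
    by (intro prod_mono_ennreal emeasure_lebesgue_unit_interval_le assms)
  finally show ?thesis using assms(2) by (simp add: ennreal_power)
qed

lemma supp_subset_cube:
  assumes "sets \<mu> = sets borel_cube"
  shows "supp \<mu> \<subseteq> cbox 0 1"
  using sets_eq_imp_space_eq[OF assms] by (auto simp: supp_def)

text \<open>
  The lower bound uses a single uniform marginal, which dominates the mass of a ball of radius
  \<open>r\<close> by the volume \<open>(2 r)\<^sup>d\<^sup>-\<^sup>1\<close> of its shadow.
\<close>

lemma dim_supp_ge:
  fixes \<mu> :: "(real ^ 'n::finite) measure"
  assumes d: "2 \<le> CARD('n)" and \<mu>: "\<mu> \<in> stochastic_uniform_marginals"
  shows "ereal (real CARD('n) - 1) \<le> hausdorff_dim (supp \<mu>)"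
proof -
  define j :: 'n where "j = undefined"
  let ?I = "UNIV - {j}"
  have prob: "prob_space \<mu>" and sets: "sets \<mu> = sets borel_cube"
    and marginal: "distr \<mu> (lebesgue_cube ?I) (drop_coord j) = lebesgue_cube ?I"
    using \<mu> by (auto simp: stochastic_uniform_marginals_def stochastic_measure_def)
  note drop[measurable] = drop_coord_measurable[OF sets, of j]
  have space: "space \<mu> = cbox 0 1"
    using sets_eq_imp_space_eq[OF sets] by simp
  have card: "card ?I = CARD('n) - 1" by (simp add: card_Diff_subset)
  have ball: "emeasure \<mu> (cball x r \<inter> space \<mu>) \<le>
      ennreal (2 ^ (CARD('n) - 1) * r powr (real CARD('n) - 1))" if r: "0 < r" for x r
  proof -
    define E where "E = PiE ?I (\<lambda>i. {x $ i - r..x $ i + r} \<inter> {0..1})"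
    have E: "E \<in> sets (lebesgue_cube ?I)"
      unfolding E_def lebesgue_cube_def by (intro sets_PiM_I_finite Int_unit_in_sets) auto
    have "drop_coord j y \<in> E" if y: "y \<in> cball x r \<inter> space \<mu>" for y
    proof -
      have "\<bar>(x - y) $ i\<bar> \<le> r" for i
        using component_le_norm_cart[of "x - y" i] y by (simp add: dist_norm)
      then have "y $ i \<in> {x $ i - r..x $ i + r}" for i
        by (simp add: abs_le_iff algebra_simps)
      then show ?thesis
        using y by (auto simp: E_def drop_coord_def space mem_box_cart)
    qed
    then have "emeasure \<mu> (cball x r \<inter> space \<mu>) \<le> emeasure \<mu> (drop_coord j -` E \<inter> space \<mu>)"
      using measurable_sets[OF drop E] by (intro emeasure_mono) auto
    also have "\<dots> = emeasure (lebesgue_cube ?I) E"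
      using emeasure_distr[OF drop E] by (simp add: marginal)
    also have "\<dots> \<le> ennreal ((2 * r) ^ card ?I)"
      unfolding E_def using r by (intro emeasure_lebesgue_cube_box_le) auto
    also have "(2 * r) ^ card ?I = 2 ^ (CARD('n) - 1) * r powr (real CARD('n) - 1)"
      using r d unfolding card
      by (simp add: power_mult_distrib powr_realpow[symmetric] of_nat_diff)
    finally show ?thesis .
  qed
  show ?thesis
    by (rule mass_distribution_principle[OF prob sets[unfolded borel_cube_def] _ _ ball])
      (use d in auto)
qed

lemma dim_supp_le:
  fixes \<mu> :: "(real ^ 'n::finite) measure"
  assumes "sets \<mu> = sets borel_cube"
  shows "hausdorff_dim (supp \<mu>) \<le> ereal (real CARD('n))"
proof -
  let ?d = "CARD('n)"
  note sub = supp_subset_cube[OF assms]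
  have "hausdorff_dim (supp \<mu>) \<le> ereal (real ?d - 1 + 1)"
  proof (rule hausdorff_dim_le_coordinate_sum[OF sub, of 2 1 "real ?d + 1"])
    fix k :: nat
    define F where "F = (\<lambda>i. real i / 2 ^ k) ` {..?d * 2 ^ k}"
    have "real (card F) \<le> real (card {..?d * 2 ^ k})"
      unfolding F_def of_nat_le_iff by (intro card_image_le) simp
    also have "\<dots> = real ?d * 2 ^ k + 1" by simp
    also have "\<dots> \<le> (real ?d + 1) * 2 ^ k" by (simp add: algebra_simps)
    finally have "real (card F) \<le> (real ?d + 1) * (real 2 ^ k) powr 1" by simp
    moreover have "\<exists>a\<in>F. (\<Sum>i\<in>UNIV. x $ i) \<in> {a..a + 1 / real 2 ^ k}" if x: "x \<in> supp \<mu>" for x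
    proof -
      let ?S = "\<Sum>i\<in>UNIV. x $ i"
      have x01: "0 \<le> x $ i" "x $ i \<le> 1" for i using x sub by (auto simp: mem_box_cart)
      have S: "0 \<le> ?S" using x01 by (intro sum_nonneg) auto
      have S': "?S \<le> ?d" using sum_mono[of UNIV "\<lambda>i. x $ i" "\<lambda>_. 1"] x01 by simp
      define n where "n = nat \<lfloor>?S * 2 ^ k\<rfloor>"
      have n: "real n \<le> ?S * 2 ^ k" "?S * 2 ^ k \<le> real n + 1"
        using S unfolding n_def by (auto simp: of_nat_nat)
      have "real n \<le> real ?d * 2 ^ k"
        using n(1) S' by (meson mult_right_mono order_trans zero_le_numeral zero_le_power)
      then have "real n \<le> real (?d * 2 ^ k)" by simp
      then have "n \<le> ?d * 2 ^ k" by (simp only: of_nat_le_iff)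
      then have "real n / 2 ^ k \<in> F" unfolding F_def by auto
      moreover have "?S \<in> {real n / 2 ^ k..real n / 2 ^ k + 1 / real 2 ^ k}"
        using n by (auto simp: field_simps)
      ultimately show ?thesis by blast
    qed
    ultimately show "\<exists>F. finite F \<and> real (card F) \<le> (real ?d + 1) * (real 2 ^ k) powr 1 \<and>
        (\<forall>x\<in>supp \<mu>. \<exists>a\<in>F. (\<Sum>i\<in>UNIV. x $ i) \<in> {a..a + 1 / real 2 ^ k})"
      by (intro exI[of _ F]) (auto simp: F_def)
  qed auto
  then show ?thesis by simp
qed

section \<open>Spreading the digits of a number\<close>

text \<open>
  The digits of \<open>v\<close> after the point in base \<open>m\<close> are read as digits in base \<open>N\<close>. For \<open>m < N\<close> the values
  form a subset of the self-similar Cantor set in which only the digits below \<open>m\<close> are used, and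
  its dimension is \<open>log N m\<close>. Reducing each digit modulo \<open>m\<close> makes the function \<open>1\<close>-periodic, so
  that shifting the digits of \<open>v\<close> is multiplication by \<open>m\<close>.
\<close>

definition spread :: "nat \<Rightarrow> nat \<Rightarrow> real \<Rightarrow> real" where
  "spread m N v = (\<Sum>k. real_of_int (\<lfloor>real m ^ Suc k * v\<rfloor> mod int m) / real N ^ Suc k)"

lemma spread_digit_bounds:
  assumes "2 \<le> m"
  shows "0 \<le> real_of_int (x mod int m)" "real_of_int (x mod int m) \<le> real m - 1"
proof -
  have "x mod int m \<le> int m - 1" using assms pos_mod_bound[of "int m" x] by simp
  then show "real_of_int (x mod int m) \<le> real m - 1" by linarith
qed (use assms in simp)

lemma spread_majorant_sums:
  assumes "2 \<le> N"
  shows "(\<lambda>k. c / real N ^ Suc k) sums (c / (real N - 1))"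
proof -
  have "(\<lambda>k. (c / N) * (1 / real N) ^ k) sums ((c / N) * (1 / (1 - 1 / real N)))"
    using assms by (intro sums_mult geometric_sums) auto
  moreover have "(c / N) * (1 / (1 - 1 / real N)) = c / (real N - 1)"
    using assms by (simp add: field_simps)
  moreover have "(\<lambda>k. (c / N) * (1 / real N) ^ k) = (\<lambda>k. c / real N ^ Suc k)"
    by (simp add: power_divide)
  ultimately show ?thesis by (simp only:)
qed

lemma spread_summable:
  assumes "2 \<le> m" "m < N"
  shows "summable (\<lambda>k. real_of_int (\<lfloor>real m ^ Suc k * v\<rfloor> mod int m) / real N ^ Suc k)"
proof (rule summable_comparison_test)
  show "summable (\<lambda>k. (real m - 1) / real N ^ Suc k)"
    using assms by (intro sums_summable[OF spread_majorant_sums]) auto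
  show "\<exists>K. \<forall>k\<ge>K. norm (real_of_int (\<lfloor>real m ^ Suc k * v\<rfloor> mod int m) / real N ^ Suc k)
      \<le> (real m - 1) / real N ^ Suc k"
    using spread_digit_bounds[OF assms(1)]
    by (intro exI[of _ 0]) (auto intro!: divide_right_mono simp: abs_of_nonneg simp del: power_Suc)
qed

lemma spread_bounds:
  assumes "2 \<le> m" "m < N"
  shows "0 \<le> spread m N v" "spread m N v \<le> (real m - 1) / (real N - 1)"
proof -
  note digit = spread_digit_bounds[OF assms(1)]
  show "0 \<le> spread m N v"
    unfolding spread_def using digit by (intro suminf_nonneg spread_summable assms) simp
  have sums: "(\<lambda>k. (real m - 1) / real N ^ Suc k) sums ((real m - 1) / (real N - 1))"
    using assms by (intro spread_majorant_sums) auto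
  show "spread m N v \<le> (real m - 1) / (real N - 1)"
    unfolding spread_def sums_unique[OF sums]
    using digit by (intro suminf_le spread_summable assms sums_summable[OF sums] divide_right_mono) auto
qed

lemma spread_rec:
  assumes "2 \<le> m" "m < N"
  shows "spread m N v = (real_of_int (\<lfloor>m * v\<rfloor> mod int m) + spread m N (m * v)) / N"
proof -
  have "spread m N v = (\<Sum>k. real_of_int (\<lfloor>real m ^ Suc (Suc k) * v\<rfloor> mod int m) / real N ^ Suc (Suc k))
      + real_of_int (\<lfloor>real m ^ Suc 0 * v\<rfloor> mod int m) / real N ^ Suc 0"
    unfolding spread_def by (subst suminf_split_head[OF spread_summable[OF assms]]) simp
  also have "(\<lambda>k. real_of_int (\<lfloor>real m ^ Suc (Suc k) * v\<rfloor> mod int m) / real N ^ Suc (Suc k)) =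
      (\<lambda>k. real_of_int (\<lfloor>real m ^ Suc k * (m * v)\<rfloor> mod int m) / real N ^ Suc k / N)"
    by (simp add: mult_ac)
  also have "(\<Sum>k. real_of_int (\<lfloor>real m ^ Suc k * (m * v)\<rfloor> mod int m) / real N ^ Suc k / N) =
      spread m N (m * v) / N"
    unfolding spread_def by (rule suminf_divide[OF spread_summable[OF assms]])
  finally show ?thesis by (simp add: add_divide_distrib)
qed

lemma spread_frac:
  assumes "2 \<le> m"
  shows "spread m N (frac v) = spread m N v"
proof -
  have "\<lfloor>real m ^ Suc k * frac v\<rfloor> mod int m = \<lfloor>real m ^ Suc k * v\<rfloor> mod int m" for k
  proof -
    have "real m ^ Suc k * v = real m ^ Suc k * frac v + of_int (int m ^ Suc k * \<lfloor>v\<rfloor>)"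
      by (simp add: frac_def algebra_simps)
    then have "\<lfloor>real m ^ Suc k * v\<rfloor> = \<lfloor>real m ^ Suc k * frac v\<rfloor> + int m ^ Suc k * \<lfloor>v\<rfloor>"
      by (simp only: floor_add_int)
    then show ?thesis by (simp add: mult.assoc)
  qed
  then show ?thesis unfolding spread_def by presburger
qed

lemma spread_measurable: "spread m N \<in> borel_measurable borel"
  unfolding spread_def[abs_def] by measurable

text \<open>
  Distinct leading digits keep two values apart, because the remaining digits contribute at most
  \<open>(m - 1) / (N - 1) < 1\<close> units of the leading place. Hence values that are close on the scale
  \<open>N\<^sup>-\<^sup>k\<close> come from arguments that share their first \<open>k\<close> digits in base \<open>m\<close>.
\<close>

lemma spread_separation:
  assumes m: "2 \<le> m" "m < N"
    and "v \<in> {0..<1}" "w \<in> {0..<1}"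
    and "\<bar>spread m N v - spread m N w\<bar> < (1 - (real m - 1) / (real N - 1)) / real N ^ k"
  shows "\<bar>v - w\<bar> \<le> 1 / real m ^ k"
  using assms(3-5)
proof (induction k arbitrary: v w)
  case 0
  then show ?case by auto
next
  case (Suc k)
  define G where "G = (real m - 1) / (real N - 1)"
  let ?g = "spread m N" and ?v = "frac (m * v)" and ?w = "frac (m * w)"
  have N: "0 < real N" "1 \<le> real N ^ k" using m by auto
  have "G < 1" unfolding G_def using m by simp
  then have small: "(1 - G) / real N ^ k \<le> 1 - G"
    using N(2) by (simp add: divide_le_eq mult_le_cancel_left1)
  have rec: "?g x = (real_of_int \<lfloor>m * x\<rfloor> + ?g (frac (m * x))) / N" if "x \<in> {0..<1}" for x :: real
  proof -
    have "0 \<le> real m * x" "real m * x < real m" using that m by auto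
    then have "\<lfloor>m * x\<rfloor> mod int m = \<lfloor>m * x\<rfloor>"
      by (intro mod_pos_pos_trivial) (auto simp: floor_less_iff)
    then show ?thesis using spread_rec[OF m, of x] by (simp add: spread_frac[OF m(1)])
  qed
  have "?g v - ?g w = (real_of_int (\<lfloor>m * v\<rfloor> - \<lfloor>m * w\<rfloor>) + (?g ?v - ?g ?w)) / N"
    unfolding rec[OF Suc.prems(1)] rec[OF Suc.prems(2)] by (simp add: diff_divide_distrib add_divide_distrib)
  then have "real_of_int (\<lfloor>m * v\<rfloor> - \<lfloor>m * w\<rfloor>) + (?g ?v - ?g ?w) = N * (?g v - ?g w)"
    using N(1) by simp
  moreover have "N * \<bar>?g v - ?g w\<bar> < (1 - G) / real N ^ k"
    using Suc.prems(3) N(1) unfolding G_def[symmetric] by (simp add: field_simps)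
  ultimately have close:
      "\<bar>real_of_int (\<lfloor>m * v\<rfloor> - \<lfloor>m * w\<rfloor>) + (?g ?v - ?g ?w)\<bar> < (1 - G) / real N ^ k"
    by (simp only: abs_mult abs_of_nat)
  have "\<bar>?g ?v - ?g ?w\<bar> \<le> G"
    using spread_bounds[OF m, of ?v] spread_bounds[OF m, of ?w] unfolding G_def by linarith
  then have "\<bar>real_of_int (\<lfloor>m * v\<rfloor> - \<lfloor>m * w\<rfloor>)\<bar> < 1" using close small by linarith
  then have eq: "\<lfloor>m * v\<rfloor> = \<lfloor>m * w\<rfloor>" by linarith
  then have "\<bar>?v - ?w\<bar> \<le> 1 / real m ^ k"
    using close by (intro Suc.IH) (auto simp: G_def frac_lt_1)
  moreover have "?v - ?w = m * (v - w)" using eq by (simp add: frac_def algebra_simps)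
  ultimately have "real m * \<bar>v - w\<bar> \<le> 1 / real m ^ k" by (simp add: abs_mult)
  then show ?case using m by (simp add: field_simps)
qed

text \<open>
  There are \<open>m\<^sup>k\<close> choices for the first \<open>k\<close> digits, and these fix the value up to \<open>N\<^sup>-\<^sup>k\<close>.
\<close>

lemma spread_cover:
  assumes "2 \<le> m" "m < N"
  shows "\<exists>F. finite F \<and> card F \<le> m ^ k \<and> (\<forall>v. \<exists>a\<in>F. spread m N v \<in> {a..a + 1 / real N ^ k})"
proof (induction k)
  case 0
  have "(real m - 1) / (real N - 1) \<le> 1" using assms by simp
  then have "spread m N v \<in> {0..0 + 1 / real N ^ 0}" for v
    using spread_bounds[OF assms, of v] by auto
  then show ?case by (intro exI[of _ "{0}"]) auto
next
  case (Suc k)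
  then obtain F where F: "finite F" "card F \<le> m ^ k"
    "\<And>v. \<exists>a\<in>F. spread m N v \<in> {a..a + 1 / real N ^ k}" by blast
  define F' where "F' = (\<lambda>(i, a). (real i + a) / N) ` ({..<m} \<times> F)"
  have "card F' \<le> card ({..<m} \<times> F)"
    unfolding F'_def using F(1) by (intro card_image_le) auto
  also have "\<dots> \<le> m ^ Suc k" using F(2) by (simp add: card_cartesian_product)
  finally have "card F' \<le> m ^ Suc k" .
  moreover have "\<exists>a\<in>F'. spread m N v \<in> {a..a + 1 / real N ^ Suc k}" for v
  proof -
    obtain a where a: "a \<in> F" "spread m N (m * v) \<in> {a..a + 1 / real N ^ k}"
      using F(3) by blast
    define i where "i = nat (\<lfloor>m * v\<rfloor> mod int m)"
    have i: "i < m" "real i = real_of_int (\<lfloor>m * v\<rfloor> mod int m)"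
      using assms unfolding i_def by (auto simp: nat_less_iff)
    have "(real i + a) / N \<in> F'" using i(1) a(1) unfolding F'_def by force
    moreover have "spread m N v \<in> {(real i + a) / N..(real i + a) / N + 1 / real N ^ Suc k}"
      unfolding spread_rec[OF assms, of v] i(2)[symmetric] using a(2) assms
      by (auto simp: divide_simps) (auto simp: algebra_simps)
    ultimately show ?thesis by blast
  qed
  ultimately show ?case using F(1) by (intro exI[of _ F']) (auto simp: F'_def)
qed

text \<open>
  The law of \<open>spread m N\<close> gives an interval of length about \<open>N\<^sup>-\<^sup>k\<close> a mass of at most about \<open>m\<^sup>-\<^sup>k\<close>,
  the length of the set of arguments with \<open>k\<close> prescribed digits; the exponent \<open>log N m\<close> turns the first into the
  second.
\<close>

lemma spread_concentration:
  assumes m: "2 \<le> m" "m < N"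
  shows "\<exists>C\<ge>0. \<forall>c \<rho>. 0 < \<rho> \<longrightarrow>
    emeasure lebesgue_unit {v \<in> {0..1}. \<bar>spread m N v - c\<bar> \<le> \<rho>} \<le> ennreal (C * \<rho> powr log N m)"
proof (intro exI conjI allI impI)
  define t where "t = log N m"
  define G where "G = (real m - 1) / (real N - 1)"
  \<comment> \<open>the factor \<open>m\<close> makes up for rounding to a scale \<open>k\<close> with \<open>N powr -(k + 1) \<le> y < N powr -k\<close>\<close>
  define C where "C = 2 * real m * (2 / (1 - G)) powr t"
  have G: "G < 1" unfolding G_def using m by simp
  have t: "0 \<le> t" unfolding t_def using m by simp
  have Nt: "real N powr t = m" unfolding t_def using m by simp
  show "0 \<le> C" unfolding C_def by simp
  fix c \<rho> :: real assume \<rho>: "0 < \<rho>"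
  let ?A = "{v \<in> {0..1}. \<bar>spread m N v - c\<bar> \<le> \<rho>}"
  have "(\<lambda>v. spread m N v) -` {c - \<rho>..c + \<rho>} \<inter> {0..1} \<in> sets lebesgue_unit"
    using measurable_sets[OF borel_measurable_lebesgue_unit[OF spread_measurable], of "{c - \<rho>..c + \<rho>}" m N]
    by simp
  also have "(\<lambda>v. spread m N v) -` {c - \<rho>..c + \<rho>} \<inter> {0..1} = ?A" by (auto simp: abs_le_iff)
  finally have A: "?A \<in> sets lebesgue_unit" .
  define y where "y = 2 * \<rho> / (1 - G)"
  have y: "0 < y" unfolding y_def using \<rho> G by simp
  have Cy: "C * \<rho> powr t = 2 * real m * y powr t"
    unfolding C_def y_def using \<rho> G by (simp add: powr_mult[symmetric])
  have "emeasure lebesgue_unit ?A \<le> ennreal (2 * real m * y powr t)"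
  proof (cases "1 \<le> y")
    case True
    have "1 \<le> y powr t" using True t by (simp add: ge_one_powr_ge_zero)
    then have "1 \<le> 2 * real m * y powr t"
      using m mult_mono[of 1 "2 * real m" 1 "y powr t"] by simp
    then have "1 \<le> ennreal (2 * real m * y powr t)" by simp
    then show ?thesis using unit.emeasure_le_1[of ?A] by (rule order_trans[rotated])
  next
    case False
    have "\<exists>n. (1 / real N) ^ n < y" using y m by (intro real_arch_pow_inv) auto
    then have ex: "\<exists>n. (1 / real N) ^ n \<le> y" using less_imp_le by blast
    define n where "n = (LEAST n. (1 / real N) ^ n \<le> y)"
    have n: "(1 / real N) ^ n \<le> y" unfolding n_def using ex by (rule LeastI_ex)
    then have "n \<noteq> 0" using False by (intro notI) simp
    then obtain k where k: "n = Suc k" using not0_implies_Suc by blast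
    have "y < (1 / real N) ^ k"
      using not_less_Least[of k "\<lambda>n. (1 / real N) ^ n \<le> y"] k n_def by auto
    then have "2 * \<rho> < (1 - G) / real N ^ k"
      using G m unfolding y_def by (simp add: field_simps power_divide)
    \<comment> \<open>the end point \<open>1\<close> has the digits of \<open>0\<close> and is removed as a null set\<close>
    then have sep: "\<bar>v - w\<bar> \<le> 1 / real m ^ k" if "v \<in> ?A - {1}" "w \<in> ?A - {1}" for v w
      using that by (intro spread_separation[OF m]) (auto simp: G_def)
    have "((1 / real N) ^ n) powr t = (1 / real N) powr (t * n)"
      using m by (simp add: powr_realpow[symmetric] powr_powr mult.commute)
    also have "\<dots> = ((1 / real N) powr t) ^ n"
      using m by (simp add: powr_realpow[symmetric] powr_powr)
    also have "\<dots> = (1 / real m) ^ n" by (simp add: powr_divide Nt)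
    finally have "1 / real m ^ k = m * ((1 / real N) ^ n) powr t"
      using m by (simp add: k power_divide)
    also have "\<dots> \<le> m * y powr t" using n t by (intro mult_left_mono powr_mono2) auto
    finally have my: "1 / real m ^ k \<le> m * y powr t" .
    have "emeasure lebesgue_unit (?A - {1}) \<le> ennreal (2 * (m * y powr t))"
    proof (cases "?A - {1} = {}")
      case False
      then obtain u where u: "u \<in> ?A - {1}" by blast
      let ?r = "m * y powr t"
      have "?A - {1} \<subseteq> {u - ?r..u + ?r} \<inter> {0..1}"
        using sep[OF u] my by (force simp: abs_le_iff)
      then have "emeasure lebesgue_unit (?A - {1}) \<le> emeasure lebesgue_unit ({u - ?r..u + ?r} \<inter> {0..1})"
        by (intro emeasure_mono Int_unit_in_sets) simp_all
      also have "\<dots> \<le> ennreal (2 * ?r)" by (intro emeasure_lebesgue_unit_interval_le) simp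
      finally show ?thesis .
    next
      case True
      show ?thesis unfolding True by simp
    qed
    moreover have "emeasure lebesgue_unit (?A - {1}) = emeasure lebesgue_unit ?A"
    proof (rule emeasure_Diff_null_set[OF _ A])
      have "{1::real} \<inter> {0..1} \<in> sets lebesgue_unit" by (rule Int_unit_in_sets) simp
      moreover have "emeasure lebesgue_unit ({1::real} \<inter> {0..1}) = 0"
        by (subst emeasure_lebesgue_unit_Int) auto
      ultimately show "{1} \<in> null_sets lebesgue_unit" by (auto simp: null_sets_def)
    qed
    ultimately show ?thesis by (simp add: mult.assoc)
  qed
  then show "emeasure lebesgue_unit ?A \<le> ennreal (C * \<rho> powr log N m)"
    using Cy unfolding t_def by simp
qed

section \<open>Measures with uniform marginals and prescribed coordinate sum\<close>

lemma borel_measurable_frac [measurable]: "frac \<in> borel_measurable (borel :: real measure)"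
  unfolding frac_def[abs_def] by measurable

lemma nn_integral_lebesgue_unit:
  assumes [measurable]: "f \<in> borel_measurable borel"
  shows "(\<integral>\<^sup>+y. f y \<partial>lebesgue_unit) = (\<integral>\<^sup>+y. indicator {0..1} y * f y \<partial>lborel)"
  unfolding lebesgue_unit_def by (subst nn_integral_restrict_space) (simp_all add: mult.commute)

text \<open>
  Reflection followed by rotation of the circle preserves length: cut the unit interval at
  \<open>frac c\<close>; the map reflects each of the two pieces.
\<close>

lemma nn_integral_frac_diff:
  assumes [measurable]: "f \<in> borel_measurable borel"
  shows "(\<integral>\<^sup>+y. f (frac (c - y)) \<partial>lebesgue_unit) = (\<integral>\<^sup>+y. f y \<partial>lebesgue_unit)"
proof -
  define a where "a = frac c"
  have a: "0 \<le> a" "a < 1" by (auto simp: a_def frac_lt_1)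
  have pieces: "indicator {0..1} y * f (frac (c - y)) =
      indicator {0..a} y * f (a - y) + indicator {a<..1} y * f (a + 1 - y)" for y
  proof -
    have "c - y = (a - y) + of_int \<lfloor>c\<rfloor>" by (simp add: a_def frac_def)
    then have "frac (c - y) = frac (a - y)" by (simp only: frac_add_of_int_right)
    moreover have "frac (a - y) = a - y" if "0 \<le> y" "y \<le> a"
      using that a by (simp add: frac_eq)
    moreover have "frac (a - y) = a + 1 - y" if "a < y" "y \<le> 1"
    proof -
      have "frac (a - y) = frac (a - y + 1)" by (simp add: frac_1_eq)
      also have "\<dots> = a - y + 1" using that a by (subst frac_eq) simp
      finally show ?thesis by simp
    qed
    ultimately show ?thesis using a by (auto simp: indicator_def)
  qed
  have "(\<integral>\<^sup>+y. f (frac (c - y)) \<partial>lebesgue_unit) =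
      (\<integral>\<^sup>+y. indicator {0..a} y * f (a - y) \<partial>lborel) +
      (\<integral>\<^sup>+y. indicator {a<..1} y * f (a + 1 - y) \<partial>lborel)"
    by (subst nn_integral_lebesgue_unit) (simp_all add: pieces nn_integral_add)
  also have "(\<integral>\<^sup>+y. indicator {0..a} y * f (a - y) \<partial>lborel) =
      (\<integral>\<^sup>+y. indicator {0..a} (a - y) * f y \<partial>lborel)"
    by (subst nn_integral_real_affine[where c = "-1" and t = a]) simp_all
  also have "(\<integral>\<^sup>+y. indicator {a<..1} y * f (a + 1 - y) \<partial>lborel) =
      (\<integral>\<^sup>+y. indicator {a<..1} (a + 1 - y) * f y \<partial>lborel)"
    by (subst nn_integral_real_affine[where c = "-1" and t = "a + 1"]) simp_all
  also have "(\<integral>\<^sup>+y. indicator {0..a} (a - y) * f y \<partial>lborel) +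
      (\<integral>\<^sup>+y. indicator {a<..1} (a + 1 - y) * f y \<partial>lborel) =
      (\<integral>\<^sup>+y. indicator {0..a} (a - y) * f y + indicator {a<..1} (a + 1 - y) * f y \<partial>lborel)"
    by (rule nn_integral_add[symmetric]) simp_all
  also have "\<dots> = (\<integral>\<^sup>+y. indicator {0..1} y * f y \<partial>lborel)"
  proof (rule nn_integral_cong_AE)
    \<comment> \<open>the reflected pieces \<open>{0..a}\<close> and \<open>{a..<1}\<close> overlap in \<open>a\<close> and miss \<open>1\<close>\<close>
    have "AE y in lborel. y \<noteq> a \<and> y \<noteq> 1"
      using AE_lborel_singleton[of a] AE_lborel_singleton[of "1::real"] by eventually_elim simp
    then show "AE y in lborel. indicator {0..a} (a - y) * f y + indicator {a<..1} (a + 1 - y) * f y =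
        indicator {0..1} y * f y"
      by eventually_elim (use a in \<open>auto simp: indicator_def\<close>)
  qed
  also have "\<dots> = (\<integral>\<^sup>+y. f y \<partial>lebesgue_unit)" by (rule nn_integral_lebesgue_unit[symmetric]) simp
  finally show ?thesis .
qed

text \<open>
  The coordinate \<open>j\<close> is chosen such that the sum of all coordinates is \<open>g (w j)\<close> modulo \<open>1\<close>.
  The entry \<open>w j\<close>, which would otherwise be lost, serves as the source of randomness for that sum.
\<close>

definition sum_twist :: "'n \<Rightarrow> (real \<Rightarrow> real) \<Rightarrow> ('n \<Rightarrow> real) \<Rightarrow> real ^ 'n::finite" where
  "sum_twist j g w =
     (\<chi> i. if i = j then frac (g (w j) - (\<Sum>i\<in>UNIV - {j}. w i)) else w i)"

definition twisted_measure :: "'n \<Rightarrow> (real \<Rightarrow> real) \<Rightarrow> (real ^ 'n::finite) measure" where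
  "twisted_measure j g = distr (lebesgue_cube UNIV) borel_cube (sum_twist j g)"

lemma sets_twisted_measure [simp]: "sets (twisted_measure j g) = sets borel_cube"
  by (simp add: twisted_measure_def)

lemma sum_twist_in_cube:
  assumes "w \<in> space (lebesgue_cube UNIV)"
  shows "sum_twist j g w \<in> cbox 0 1"
  using assms frac_lt_1 less_imp_le
  by (fastforce simp: sum_twist_def mem_box_cart space_lebesgue_cube PiE_iff)

lemma component_borel_measurable:
  "i \<in> I \<Longrightarrow> (\<lambda>w. w i) \<in> borel_measurable (lebesgue_cube I)"
  unfolding lebesgue_cube_def
  by (rule measurable_compose[OF measurable_component_singleton[of i I "\<lambda>_. lebesgue_unit"]])
     (auto intro: borel_measurable_lebesgue_unit)

lemma sum_twist_measurable:
  fixes j :: "'n::finite"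
  assumes g: "g \<in> borel_measurable borel"
  shows "sum_twist j g \<in> measurable (lebesgue_cube UNIV) borel_cube"
  unfolding borel_cube_def
proof (rule measurable_restrict_space2)
  have w: "(\<lambda>w. w i) \<in> borel_measurable (lebesgue_cube UNIV)" for i :: 'n
    by (rule component_borel_measurable) simp
  have "(\<lambda>w. sum_twist j g w $ i) \<in> borel_measurable (lebesgue_cube UNIV)" for i
  proof (cases "i = j")
    case True
    have "(\<lambda>w. g (w j) - (\<Sum>i\<in>UNIV - {j}. w i)) \<in> borel_measurable (lebesgue_cube UNIV)"
      by (intro borel_measurable_diff borel_measurable_sum measurable_compose[OF w g] w)
    from measurable_compose[OF this borel_measurable_frac] show ?thesis
      by (simp add: sum_twist_def True)
  qed (simp add: sum_twist_def w)
  then show "sum_twist j g \<in> borel_measurable (lebesgue_cube UNIV)"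
    by (auto simp: borel_measurable_euclidean_space[of "sum_twist j g"] Basis_vec_def inner_axis)
qed (use sum_twist_in_cube in auto)

lemma prob_space_twisted_measure:
  fixes j :: "'n::finite"
  assumes "g \<in> borel_measurable borel"
  shows "prob_space (twisted_measure j g)"
  unfolding twisted_measure_def lebesgue_cube_def
  using sum_twist_measurable[OF assms, of j] unfolding lebesgue_cube_def
  by (rule cube.prob_space_distr)

lemma emeasure_twisted_measure:
  fixes j :: "'n::finite"
  assumes "g \<in> borel_measurable borel" "A \<in> sets borel_cube"
  shows "emeasure (twisted_measure j g) A =
    emeasure (lebesgue_cube UNIV) (sum_twist j g -` A \<inter> space (lebesgue_cube UNIV))"
  unfolding twisted_measure_def by (rule emeasure_distr[OF sum_twist_measurable[OF assms(1)] assms(2)])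

text \<open>
  Conditionally on \<open>g (w j)\<close>, any \<open>d - 1\<close> coordinates of \<open>sum_twist j g w\<close> are independent and
  uniform. If the coordinate \<open>l \<noteq> j\<close> is dropped, this is seen by integrating over \<open>w l\<close> first: with all other
  entries of \<open>w\<close> fixed, the coordinate \<open>j\<close> is \<open>frac (c - w l)\<close> for a constant \<open>c\<close>, hence uniform.
\<close>

lemma twisted_measure_marginal:
  fixes j l :: "'n::finite"
  assumes g: "g \<in> borel_measurable borel"
  shows "distr (twisted_measure j g) (lebesgue_cube (UNIV - {l})) (drop_coord l) =
    lebesgue_cube (UNIV - {l})"
proof -
  let ?I = "UNIV - {l}"
  let ?T = "\<lambda>w. drop_coord l (sum_twist j g w)"
  note twist = sum_twist_measurable[OF g, of j]
  have drop: "drop_coord l \<in> measurable borel_cube (lebesgue_cube ?I)"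
    by (rule drop_coord_measurable) simp
  have T: "?T \<in> measurable (lebesgue_cube UNIV) (lebesgue_cube ?I)"
    by (rule measurable_compose[OF twist drop])
  have "distr (lebesgue_cube UNIV) (lebesgue_cube ?I) ?T = lebesgue_cube ?I"
    unfolding lebesgue_cube_def[of ?I]
  proof (rule cube.PiM_eqI)
    fix A :: "'n \<Rightarrow> real set" assume A: "\<And>i. i \<in> ?I \<Longrightarrow> A i \<in> sets lebesgue_unit"
    have Ti: "?T w i = w i" if "i \<noteq> j" "i \<noteq> l" for i w
      using that by (simp add: drop_coord_def sum_twist_def)
    have ext: "?T w \<in> extensional ?I" for w by (simp add: drop_coord_def)
    have A_borel: "A i \<in> sets borel" "A i \<subseteq> {0..1}" if "i \<in> ?I" for i
      using A[OF that] unfolding sets_lebesgue_unit by (auto simp: sets_restrict_space)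
    have EA: "PiE ?I A \<in> sets (lebesgue_cube ?I)"
      unfolding lebesgue_cube_def using A by (intro sets_PiM_I_finite) auto
    have "emeasure (distr (lebesgue_cube UNIV) (lebesgue_cube ?I) ?T) (PiE ?I A) =
        (\<Prod>i\<in>?I. emeasure lebesgue_unit (A i))"
    proof (cases "l = j")
      case True
      have B: "PiE UNIV (A(l := {0..1})) \<in> sets (lebesgue_cube UNIV)"
        unfolding lebesgue_cube_def using A sets.top[of lebesgue_unit]
        by (intro sets_PiM_I_finite) auto
      have "?T -` PiE ?I A \<inter> space (lebesgue_cube UNIV) = PiE UNIV (A(l := {0..1}))"
      proof (intro set_eqI iffI)
        fix w assume w: "w \<in> ?T -` PiE ?I A \<inter> space (lebesgue_cube UNIV)"
        have "w i \<in> (A(l := {0..1})) i" for i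
        proof (cases "i = l")
          case False
          then have "?T w i \<in> A i" using w by (intro PiE_mem[of "?T w" ?I]) auto
          then show ?thesis using False Ti[of i w] True by simp
        qed (use w in \<open>auto simp: space_lebesgue_cube PiE_iff\<close>)
        then show "w \<in> PiE UNIV (A(l := {0..1}))" by (simp add: PiE_UNIV_domain)
      next
        fix w assume "w \<in> PiE UNIV (A(l := {0..1}))"
        then have w: "w i \<in> (A(l := {0..1})) i" for i by (rule PiE_mem) simp
        have "?T w i \<in> A i" if "i \<in> ?I" for i
          using that w[of i] Ti[of i w] True by simp
        then have "?T w \<in> PiE ?I A" using ext by (auto simp: PiE_iff)
        moreover have "w i \<in> {0..1}" for i
          using w[of i] A_borel(2)[of i] by (cases "i = l") auto
        ultimately show "w \<in> ?T -` PiE ?I A \<inter> space (lebesgue_cube UNIV)"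
          by (simp add: space_lebesgue_cube PiE_UNIV_domain)
      qed
      then have "emeasure (distr (lebesgue_cube UNIV) (lebesgue_cube ?I) ?T) (PiE ?I A) =
          emeasure (lebesgue_cube UNIV) (PiE UNIV (A(l := {0..1})))"
        by (simp add: emeasure_distr[OF T EA])
      also have "\<dots> = (\<Prod>i\<in>UNIV. emeasure lebesgue_unit ((A(l := {0..1})) i))"
        unfolding lebesgue_cube_def using A sets.top[of lebesgue_unit]
        by (intro cube.emeasure_PiM) auto
      also have "\<dots> = (\<Prod>i\<in>?I. emeasure lebesgue_unit (A i))"
        using unit.emeasure_space_1 by (simp add: prod.remove[of UNIV l])
      finally show ?thesis .
    next
      case False
      define B where "B = PiE ?I (A(j := {0..1}))"
      define c where "c x = g (x j) - (\<Sum>i\<in>UNIV - {j, l}. x i)" for x :: "'n \<Rightarrow> real"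
      let ?f = "\<lambda>w. indicator (PiE ?I A) (?T w) :: ennreal"
      have f: "?f \<in> borel_measurable (PiM (insert l ?I) (\<lambda>_. lebesgue_unit))"
        using measurable_compose[OF T borel_measurable_indicator[OF EA]] by (simp add: lebesgue_cube_def insert_absorb)
      have B: "B \<in> sets (lebesgue_cube ?I)"
        unfolding lebesgue_cube_def B_def using A sets.top[of lebesgue_unit]
        by (intro sets_PiM_I_finite) auto
      have Aj: "A j \<in> sets lebesgue_unit" using A False by simp
      have inner: "(\<integral>\<^sup>+y. ?f (x(l := y)) \<partial>lebesgue_unit) =
          emeasure lebesgue_unit (A j) * indicator B x"
        if x: "x \<in> space (PiM ?I (\<lambda>_. lebesgue_unit))" for x
      proof -
        have "?f (x(l := y)) = indicator B x * indicator (A j) (frac (c x - y))" for y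
        proof -
          have "(\<Sum>i\<in>UNIV - {j}. (x(l := y)) i) = y + (\<Sum>i\<in>UNIV - {j, l}. x i)"
            using False by (subst sum.remove[of _ l]) (auto simp: Diff_insert2[symmetric] insert_commute intro!: sum.cong)
          then have Tj: "?T (x(l := y)) j = frac (c x - y)"
            using False by (simp add: drop_coord_def sum_twist_def c_def algebra_simps)
          have "?T (x(l := y)) \<in> PiE ?I A \<longleftrightarrow> x \<in> B \<and> frac (c x - y) \<in> A j"
          proof
            assume L: "?T (x(l := y)) \<in> PiE ?I A"
            have "x i \<in> (A(j := {0..1})) i" if "i \<in> ?I" for i
            proof (cases "i = j")
              case False
              then show ?thesis using PiE_mem[OF L that] Ti[of i "x(l := y)"] that by simp
            qed (use that x in \<open>auto simp: PiE_iff space_PiM\<close>)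
            moreover have "x \<in> extensional ?I" using x by (simp add: space_PiM PiE_iff)
            moreover have "frac (c x - y) \<in> A j" using PiE_mem[OF L, of j] Tj False by simp
            ultimately show "x \<in> B \<and> frac (c x - y) \<in> A j" by (auto simp: B_def PiE_iff)
          next
            assume R: "x \<in> B \<and> frac (c x - y) \<in> A j"
            have "?T (x(l := y)) i \<in> A i" if "i \<in> ?I" for i
            proof (cases "i = j")
              case False
              have "x \<in> PiE ?I (A(j := {0..1}))" using R by (simp add: B_def)
              from PiE_mem[OF this that] have "x i \<in> (A(j := {0..1})) i" .
              then show ?thesis using Ti[of i "x(l := y)"] that False by simp
            qed (use R Tj in simp)
            then show "?T (x(l := y)) \<in> PiE ?I A" using ext by (auto simp: PiE_iff)
          qed
          then show ?thesis by (auto simp: indicator_def)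
        qed
        moreover have "(\<integral>\<^sup>+y. indicator (A j) (frac (c x - y)) \<partial>lebesgue_unit) =
            (\<integral>\<^sup>+y. indicator (A j) y \<partial>lebesgue_unit)"
          using A_borel False by (intro nn_integral_frac_diff) auto
        moreover have "(\<lambda>y. indicator (A j) (frac (c x - y)) :: ennreal) \<in> borel_measurable lebesgue_unit"
          using A_borel(1)[of j] False by (intro borel_measurable_lebesgue_unit) simp
        ultimately show ?thesis using Aj by (simp add: nn_integral_cmult mult.commute)
      qed
      have "emeasure (distr (lebesgue_cube UNIV) (lebesgue_cube ?I) ?T) (PiE ?I A) =
          (\<integral>\<^sup>+w. indicator (PiE ?I A) w \<partial>distr (lebesgue_cube UNIV) (lebesgue_cube ?I) ?T)"
        using EA by simp
      also have "\<dots> = (\<integral>\<^sup>+w. ?f w \<partial>lebesgue_cube UNIV)"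
        using T EA by (intro nn_integral_distr) auto
      also have "\<dots> = (\<integral>\<^sup>+w. ?f w \<partial>PiM (insert l ?I) (\<lambda>_. lebesgue_unit))"
        by (simp add: lebesgue_cube_def insert_absorb)
      also have "\<dots> = (\<integral>\<^sup>+x. (\<integral>\<^sup>+y. ?f (x(l := y)) \<partial>lebesgue_unit) \<partial>PiM ?I (\<lambda>_. lebesgue_unit))"
        by (rule cube.product_nn_integral_insert[OF _ _ f]) auto
      also have "\<dots> = (\<integral>\<^sup>+x. emeasure lebesgue_unit (A j) * indicator B x \<partial>PiM ?I (\<lambda>_. lebesgue_unit))"
        by (intro nn_integral_cong inner)
      also have "\<dots> = emeasure lebesgue_unit (A j) * emeasure (PiM ?I (\<lambda>_. lebesgue_unit)) B"
        using B by (simp add: nn_integral_cmult_indicator lebesgue_cube_def)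
      also have "emeasure (PiM ?I (\<lambda>_. lebesgue_unit)) B =
          (\<Prod>i\<in>?I. emeasure lebesgue_unit ((A(j := {0..1})) i))"
        unfolding B_def using A sets.top[of lebesgue_unit] by (intro cube.emeasure_PiM) auto
      also have "\<dots> = (\<Prod>i\<in>?I - {j}. emeasure lebesgue_unit (A i))"
        using unit.emeasure_space_1 False by (simp add: prod.remove[of ?I j])
      also have "emeasure lebesgue_unit (A j) * \<dots> = (\<Prod>i\<in>?I. emeasure lebesgue_unit (A i))"
        using False by (simp add: prod.remove[of ?I j])
      finally show ?thesis .
    qed
    then show "emeasure (distr (lebesgue_cube UNIV) (PiM ?I (\<lambda>_. lebesgue_unit)) ?T) (PiE ?I A) =
        (\<Prod>i\<in>?I. emeasure lebesgue_unit (A i))"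
      by (simp add: lebesgue_cube_def)
  qed simp_all
  then show ?thesis
    unfolding twisted_measure_def by (simp add: distr_distr[OF drop twist] comp_def)
qed

lemma twisted_measure_uniform_marginals:
  fixes j :: "'n::finite"
  assumes d: "2 \<le> CARD('n)" and g: "g \<in> borel_measurable borel"
  shows "twisted_measure j g \<in> stochastic_uniform_marginals"
proof -
  let ?\<mu> = "twisted_measure j g"
  have "distr ?\<mu> lebesgue_unit (\<lambda>x. x $ i) = lebesgue_unit" for i
  proof -
    have "UNIV \<noteq> {i}"
    proof
      assume "UNIV = {i}"
      then have "CARD('n) = card {i}" by (rule arg_cong)
      then show False using d by simp
    qed
    then obtain l where l: "l \<noteq> i" by blast
    let ?I = "UNIV - {l}"
    have i: "i \<in> ?I" using l by simp
    have "distr (distr ?\<mu> (lebesgue_cube ?I) (drop_coord l)) lebesgue_unit (\<lambda>w. w i) =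
        distr ?\<mu> lebesgue_unit ((\<lambda>w. w i) \<circ> drop_coord l)"
      using i by (intro distr_distr drop_coord_measurable) (auto simp: lebesgue_cube_def)
    also have "(\<lambda>w. w i) \<circ> drop_coord l = (\<lambda>x. x $ i)"
      using i by (auto simp: drop_coord_def)
    also have "distr (distr ?\<mu> (lebesgue_cube ?I) (drop_coord l)) lebesgue_unit (\<lambda>w. w i) = lebesgue_unit"
      unfolding twisted_measure_marginal[OF g] unfolding lebesgue_cube_def by (rule cube.PiM_component[OF i])
    finally show ?thesis by simp
  qed
  then show ?thesis
    by (simp add: stochastic_uniform_marginals_def stochastic_measure_def
        prob_space_twisted_measure[OF g] twisted_measure_marginal[OF g])
qed

text \<open>
  The coordinate sum is congruent to \<open>g (w j)\<close> modulo \<open>1\<close> by construction; only finitely many integer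
  differences occur because both quantities are bounded.
\<close>

lemma sum_sum_twist:
  fixes j :: "'n::finite"
  assumes g: "\<And>v. 0 \<le> g v" "\<And>v. g v \<le> 1" and w: "w \<in> space (lebesgue_cube UNIV)"
  shows "\<exists>n\<in>{- int CARD('n)..int CARD('n)}.
    (\<Sum>i\<in>UNIV. sum_twist j g w $ i) = g (w j) - of_int n"
proof -
  define q where "q = g (w j) - (\<Sum>i\<in>UNIV - {j}. w i)"
  have w01: "0 \<le> w i" "w i \<le> 1" for i using w by (auto simp: space_lebesgue_cube PiE_iff)
  have "0 \<le> (\<Sum>i\<in>UNIV - {j}. w i)" using w01 by (intro sum_nonneg) auto
  moreover have "(\<Sum>i\<in>UNIV - {j}. w i) \<le> (\<Sum>i\<in>UNIV - {j}. 1)" using w01 by (intro sum_mono) auto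
  moreover have "(\<Sum>i\<in>UNIV - {j}. 1) \<le> real CARD('n)" by (simp add: card_Diff_subset)
  ultimately have "- real CARD('n) \<le> q" "q \<le> 1"
    unfolding q_def using g[of "w j"] by linarith+
  then have "- int CARD('n) \<le> \<lfloor>q\<rfloor>" "\<lfloor>q\<rfloor> \<le> 1" by (simp_all add: le_floor_iff floor_le_iff)
  moreover have "1 \<le> int CARD('n)" by (simp add: Suc_leI)
  ultimately have "\<lfloor>q\<rfloor> \<in> {- int CARD('n)..int CARD('n)}"
    by (metis atLeastAtMost_iff order_trans)
  moreover have "(\<Sum>i\<in>UNIV. sum_twist j g w $ i) = frac q + (\<Sum>i\<in>UNIV - {j}. w i)"
    by (simp add: sum.remove[of UNIV j] sum_twist_def q_def)
  ultimately show ?thesis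
    by (intro bexI[of _ "\<lfloor>q\<rfloor>"]) (auto simp: frac_def q_def)
qed

text \<open>
  The support lies in every closed set that contains all values of \<open>sum_twist j g\<close>, in particular
  in the set of points whose coordinate sum lies in an integer translate of the cover of the range
  of \<open>g\<close>.
\<close>

lemma dim_supp_twisted_measure_le:
  fixes j :: "'n::finite"
  assumes g: "g \<in> borel_measurable borel" "\<And>v. 0 \<le> g v" "\<And>v. g v \<le> 1"
    and N: "2 \<le> N" and t: "0 \<le> t"
    and cover: "\<And>k::nat. \<exists>F. finite F \<and> real (card F) \<le> (real N ^ k) powr t \<and>
      (\<forall>v. \<exists>a\<in>F. g v \<in> {a..a + 1 / real N ^ k})"
  shows "hausdorff_dim (supp (twisted_measure j g)) \<le> ereal (real CARD('n) - 1 + t)"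
proof (rule hausdorff_dim_le_coordinate_sum[OF supp_subset_cube[OF sets_twisted_measure] N t])
  let ?d = "CARD('n)" and ?\<mu> = "twisted_measure j g"
  show "0 \<le> real (2 * ?d + 1)" by simp
  fix k :: nat
  obtain F where F: "finite F" "real (card F) \<le> (real N ^ k) powr t"
    "\<And>v. \<exists>a\<in>F. g v \<in> {a..a + 1 / real N ^ k}" using cover[of k] by blast
  define F' where "F' = (\<lambda>(a, n). a - real_of_int n) ` (F \<times> {- int ?d..int ?d})"
  have finF': "finite F'" using F(1) by (simp add: F'_def)
  have cardZ: "card {- int ?d..int ?d} = 2 * ?d + 1" by (simp add: nat_add_distrib)
  have "card F' \<le> card (F \<times> {- int ?d..int ?d})"
    unfolding F'_def using F(1) by (intro card_image_le) auto
  also have "\<dots> = (2 * ?d + 1) * card F"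
    unfolding card_cartesian_product cardZ by simp
  finally have "real (card F') \<le> real (2 * ?d + 1) * real (card F)"
    by (simp only: of_nat_le_iff flip: of_nat_mult)
  then have card: "real (card F') \<le> real (2 * ?d + 1) * (real N ^ k) powr t"
    by (rule order_trans) (use F(2) in \<open>intro mult_left_mono, auto\<close>)
  define K :: "(real ^ 'n) set"
    where "K = (\<Union>a\<in>F'. {x. (\<Sum>i\<in>UNIV. x $ i) \<in> {a..a + 1 / real N ^ k}})"
  have "closed {x :: real ^ 'n. (\<Sum>i\<in>UNIV. x $ i) \<in> {a..a + 1 / real N ^ k}}" for a
    unfolding atLeastAtMost_iff by (intro closed_Collect_conj closed_Collect_le continuous_intros)
  then have K: "closed K" unfolding K_def using finF' by (intro closed_UN) auto
  have "sum_twist j g w \<in> K" if w: "w \<in> space (lebesgue_cube UNIV)" for w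
  proof -
    obtain n where n: "n \<in> {- int ?d..int ?d}"
      "(\<Sum>i\<in>UNIV. sum_twist j g w $ i) = g (w j) - of_int n"
      using sum_sum_twist[where g = g and j = j, OF g(2,3) w] by blast
    obtain a where a: "a \<in> F" "g (w j) \<in> {a..a + 1 / real N ^ k}" using F(3) by blast
    have "a - real_of_int n \<in> F'" using a(1) n(1) unfolding F'_def by force
    moreover have "(\<Sum>i\<in>UNIV. sum_twist j g w $ i) \<in>
        {a - real_of_int n..a - real_of_int n + 1 / real N ^ k}"
      using a(2) n(2) by auto
    ultimately show ?thesis unfolding K_def by blast
  qed
  then have "sum_twist j g -` (space ?\<mu> - K) \<inter> space (lebesgue_cube UNIV) = {}" by auto
  moreover have "space ?\<mu> - K \<in> sets borel_cube"
  proof -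
    have "- K \<in> sets borel" using K by (intro borel_open) (simp add: open_closed)
    then have "cbox 0 1 \<inter> (- K) \<in> sets borel_cube"
      unfolding borel_cube_def sets_restrict_space by (rule imageI)
    then show ?thesis by (simp add: twisted_measure_def Diff_eq)
  qed
  ultimately have "emeasure ?\<mu> (space ?\<mu> - K) = 0"
    by (simp add: emeasure_twisted_measure[OF g(1)])
  then have "supp ?\<mu> \<subseteq> K" by (rule supp_subset_closed[OF K])
  then show "\<exists>F. finite F \<and> real (card F) \<le> real (2 * ?d + 1) * (real N ^ k) powr t \<and>
      (\<forall>x\<in>supp ?\<mu>. \<exists>a\<in>F. (\<Sum>i\<in>UNIV. x $ i) \<in> {a..a + 1 / real N ^ k})"
    using finF' card unfolding K_def by (intro exI[of _ F']) blast
qed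

text \<open>
  The mass of a ball of radius \<open>r\<close>: the coordinates other than \<open>j\<close> contribute a factor \<open>2 r\<close>
  each, and since the coordinate sum varies by at most \<open>d r\<close> on the ball, \<open>g (w j)\<close> lies in one of
  \<open>2 d + 1\<close> intervals of that size.
\<close>

lemma dim_supp_twisted_measure_ge:
  fixes j :: "'n::finite"
  assumes d: "2 \<le> CARD('n)"
    and g: "g \<in> borel_measurable borel" "\<And>v. 0 \<le> g v" "\<And>v. g v \<le> 1"
    and C: "0 \<le> C" and t: "0 \<le> t"
    and conc: "\<And>c \<rho>. 0 < \<rho> \<Longrightarrow>
      emeasure lebesgue_unit {v \<in> {0..1}. \<bar>g v - c\<bar> \<le> \<rho>} \<le> ennreal (C * \<rho> powr t)"
  shows "ereal (real CARD('n) - 1 + t) \<le> hausdorff_dim (supp (twisted_measure j g))"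
proof -
  let ?d = "CARD('n)" and ?\<mu> = "twisted_measure j g"
  \<comment> \<open>the estimate holds with \<open>D\<close>, but the mass distribution principle asks for a positive constant\<close>
  define D where "D = 2 ^ (?d - 1) * ((2 * real ?d + 1) * C * real ?d powr t)"
  have D: "0 \<le> D" unfolding D_def using C by simp
  have ball: "emeasure ?\<mu> (cball x r \<inter> space ?\<mu>) \<le> ennreal ((D + 1) * r powr (real ?d - 1 + t))"
    if r: "0 < r" for x r
  proof -
    define S where "S = (\<Sum>i\<in>UNIV. x $ i)"
    define Z where "Z = {- int ?d..int ?d}"
    define A where "A n = {v \<in> {0..1}. \<bar>g v - (S + of_int n)\<bar> \<le> ?d * r}" for n
    define B where "B i = (if i = j then (\<Union>n\<in>Z. A n) else {x $ i - r..x $ i + r} \<inter> {0..1})" for i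
    have finZ: "finite Z" by (simp add: Z_def)
    have cardZ: "card Z = 2 * ?d + 1" by (simp add: Z_def nat_add_distrib)
    have dr: "0 < ?d * r" using r by simp
    have A: "A n \<in> sets lebesgue_unit" for n
    proof -
      have "g -` {S + n - ?d * r..S + n + ?d * r} \<in> sets borel"
        using measurable_sets[OF g(1), of "{S + n - ?d * r..S + n + ?d * r}"] by simp
      then have "g -` {S + n - ?d * r..S + n + ?d * r} \<inter> {0..1} \<in> sets lebesgue_unit"
        by (rule Int_unit_in_sets)
      also have "g -` {S + n - ?d * r..S + n + ?d * r} \<inter> {0..1} = A n"
        unfolding A_def by (auto simp: abs_le_iff)
      finally show ?thesis .
    qed
    have B: "B i \<in> sets lebesgue_unit" for i
      unfolding B_def using A finZ by (cases "i = j") (auto intro!: Int_unit_in_sets simp del: Int_atLeastAtMost)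
    have "emeasure lebesgue_unit (B j) \<le> (\<Sum>n\<in>Z. emeasure lebesgue_unit (A n))"
      unfolding B_def using finZ A by (auto intro!: emeasure_subadditive_finite)
    also have "\<dots> \<le> (\<Sum>n\<in>Z. ennreal (C * (?d * r) powr t))"
      unfolding A_def by (intro sum_mono conc dr)
    also have "\<dots> = ennreal (real (card Z) * (C * (?d * r) powr t))"
      by (simp add: ennreal_of_nat_eq_real_of_nat flip: ennreal_mult')
    also have "real (card Z) * (C * (?d * r) powr t) = (2 * real ?d + 1) * C * real ?d powr t * r powr t"
      using r by (simp add: cardZ powr_mult)
    finally have Bj: "emeasure lebesgue_unit (B j) \<le>
        ennreal ((2 * real ?d + 1) * C * real ?d powr t * r powr t)" .
    have sub: "sum_twist j g -` (cball x r \<inter> space ?\<mu>) \<inter> space (lebesgue_cube UNIV) \<subseteq> PiE UNIV B"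
    proof
      fix w assume "w \<in> sum_twist j g -` (cball x r \<inter> space ?\<mu>) \<inter> space (lebesgue_cube UNIV)"
      then have w: "w \<in> space (lebesgue_cube UNIV)" "dist x (sum_twist j g w) \<le> r" by auto
      let ?y = "sum_twist j g w"
      have comp: "\<bar>x $ i - ?y $ i\<bar> \<le> r" for i
        using component_le_norm_cart[of "x - ?y" i] w(2) by (simp add: dist_norm)
      have w01: "w i \<in> {0..1}" for i using w(1) by (auto simp: space_lebesgue_cube PiE_iff)
      have "w i \<in> B i" for i
      proof (cases "i = j")
        case True
        obtain n where n: "n \<in> Z" "(\<Sum>i\<in>UNIV. ?y $ i) = g (w j) - of_int n"
          using sum_sum_twist[where g = g and j = j, OF g(2,3) w(1)] unfolding Z_def by blast
        have "\<bar>S - (\<Sum>i\<in>UNIV. ?y $ i)\<bar> \<le> (\<Sum>i\<in>UNIV. \<bar>x $ i - ?y $ i\<bar>)"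
          unfolding S_def sum_subtractf[symmetric] by (rule sum_abs)
        also have "\<dots> \<le> (\<Sum>i\<in>(UNIV :: 'n set). r)" using comp by (intro sum_mono) auto
        finally have "\<bar>g (w j) - (S + of_int n)\<bar> \<le> ?d * r" unfolding n(2) by simp
        then have "w j \<in> A n" using w01[of j] by (auto simp: A_def)
        then show ?thesis using n(1) True by (auto simp: B_def)
      next
        case False
        have "?y $ i = w i" using False by (simp add: sum_twist_def)
        then show ?thesis using comp[of i] w01[of i] False by (auto simp: B_def abs_le_iff)
      qed
      then show "w \<in> PiE UNIV B" by (auto simp: PiE_iff)
    qed
    have "cbox 0 1 \<inter> cball x r \<in> sets borel_cube"
      unfolding borel_cube_def sets_restrict_space by simp
    then have "cball x r \<inter> space ?\<mu> \<in> sets borel_cube"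
      by (simp add: twisted_measure_def Int_commute)
    then have "emeasure ?\<mu> (cball x r \<inter> space ?\<mu>) =
        emeasure (lebesgue_cube UNIV) (sum_twist j g -` (cball x r \<inter> space ?\<mu>) \<inter> space (lebesgue_cube UNIV))"
      by (rule emeasure_twisted_measure[OF g(1)])
    also have "\<dots> \<le> emeasure (lebesgue_cube UNIV) (PiE UNIV B)"
      using sub B unfolding lebesgue_cube_def by (intro emeasure_mono sets_PiM_I_finite) auto
    also have "\<dots> = (\<Prod>i\<in>UNIV. emeasure lebesgue_unit (B i))"
      unfolding lebesgue_cube_def using B by (intro cube.emeasure_PiM) auto
    also have "\<dots> = emeasure lebesgue_unit (B j) * (\<Prod>i\<in>UNIV - {j}. emeasure lebesgue_unit (B i))"
      by (simp add: prod.remove[of UNIV j])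
    also have "\<dots> \<le> ennreal ((2 * real ?d + 1) * C * real ?d powr t * r powr t) *
        (\<Prod>i\<in>UNIV - {j}. ennreal (2 * r))"
      using emeasure_lebesgue_unit_interval_le[OF less_imp_le[OF r]]
      by (intro mult_mono Bj prod_mono_ennreal) (auto simp: B_def simp del: Int_atLeastAtMost)
    also have "(\<Prod>i\<in>UNIV - {j}. ennreal (2 * r)) = ennreal ((2 * r) ^ (?d - 1))"
      using r by (simp add: ennreal_power card_Diff_subset)
    also have "ennreal ((2 * real ?d + 1) * C * real ?d powr t * r powr t) * \<dots> =
        ennreal (((2 * real ?d + 1) * C * real ?d powr t * r powr t) * (2 * r) ^ (?d - 1))"
      using C r by (intro ennreal_mult[symmetric]) auto
    also have "((2 * real ?d + 1) * C * real ?d powr t * r powr t) * (2 * r) ^ (?d - 1) =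
        D * r powr (real ?d - 1 + t)"
    proof -
      have "r ^ (?d - 1) = r powr (real ?d - 1)"
        using r d by (simp add: powr_realpow[symmetric] of_nat_diff)
      then show ?thesis by (simp add: D_def power_mult_distrib powr_add mult_ac)
    qed
    finally have "emeasure ?\<mu> (cball x r \<inter> space ?\<mu>) \<le> ennreal (D * r powr (real ?d - 1 + t))" .
    also have "\<dots> \<le> ennreal ((D + 1) * r powr (real ?d - 1 + t))"
      by (intro ennreal_leI mult_right_mono) auto
    finally show ?thesis .
  qed
  show ?thesis
    by (rule mass_distribution_principle[OF prob_space_twisted_measure[OF g(1)] _ _ _ ball])
      (use d t D in \<open>auto simp: borel_cube_def\<close>)
qed

lemma dim_supp_twisted_spread:
  fixes j :: "'n::finite"
  assumes d: "2 \<le> CARD('n)" and m: "2 \<le> m" "m < N"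
  shows "hausdorff_dim (supp (twisted_measure j (spread m N))) = ereal (real CARD('n) - 1 + log N m)"
proof (rule antisym)
  have t: "0 \<le> log N m" using m by simp
  have "(real m - 1) / (real N - 1) \<le> 1" using m by simp
  then have le1: "spread m N v \<le> 1" for v using spread_bounds(2)[OF m, of v] by linarith
  note g = spread_measurable spread_bounds(1)[OF m] le1
  have "(real N ^ k) powr log N m = real m ^ k" for k
  proof -
    have "(real N ^ k) powr log N m = (real N powr log N m) powr k"
      using m by (simp add: powr_realpow[symmetric] powr_powr mult.commute del: powr_log_cancel)
    moreover have "real N powr log N m = m" using m by simp
    ultimately show ?thesis using m by (simp add: powr_realpow)
  qed
  then have cover: "\<exists>F. finite F \<and> real (card F) \<le> (real N ^ k) powr log N m \<and>
      (\<forall>v. \<exists>a\<in>F. spread m N v \<in> {a..a + 1 / real N ^ k})" for k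
    using spread_cover[OF m, of k] by (metis of_nat_le_iff of_nat_power)
  show "hausdorff_dim (supp (twisted_measure j (spread m N))) \<le> ereal (real CARD('n) - 1 + log N m)"
    by (rule dim_supp_twisted_measure_le[OF g _ t cover]) (use m in auto)
  obtain C where C: "0 \<le> C" "\<And>c \<rho>. 0 < \<rho> \<Longrightarrow>
      emeasure lebesgue_unit {v \<in> {0..1}. \<bar>spread m N v - c\<bar> \<le> \<rho>} \<le> ennreal (C * \<rho> powr log N m)"
    using spread_concentration[OF m] by blast
  show "ereal (real CARD('n) - 1 + log N m) \<le> hausdorff_dim (supp (twisted_measure j (spread m N)))"
    by (rule dim_supp_twisted_measure_ge[OF d g C(1) t C(2)])
qed

section \<open>Density of the dimensions\<close>

lemma unit_interval_subset_closure_fractions: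
  "{0..1} \<subseteq> closure {real p / real q | p q. 0 < p \<and> p < q}" (is "_ \<subseteq> closure ?T")
proof -
  have "{0<..<1} \<subseteq> closure ?T"
  proof
    fix x :: real assume x: "x \<in> {0<..<1}"
    show "x \<in> closure ?T"
      unfolding closure_approachable
    proof (intro allI impI)
      fix e :: real assume "0 < e"
      then have "max 0 (x - e) < x" using x by auto
      then obtain s where s: "s \<in> \<rat>" "max 0 (x - e) < s" "s < x"
        using Rats_dense_in_real by blast
      then obtain p q :: nat where pq: "q \<noteq> 0" "\<bar>s\<bar> = real p / real q"
        using Rats_abs_nat_div_natE by metis
      have s01: "0 < s" "s < 1" using s x by auto
      have s_eq: "s = real p / real q" using pq(2) s01(1) by simp
      have "0 < p" using s_eq s01(1) by (auto intro: Nat.gr0I)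
      moreover have "p < q" using s_eq s01(2) pq(1) by (simp add: divide_less_eq)
      ultimately have "s \<in> ?T" using s_eq by blast
      moreover have "dist s x < e" using s by (simp add: dist_real_def)
      ultimately show "\<exists>y\<in>?T. dist y x < e" by blast
    qed
  qed
  then have "closure {0<..<1} \<subseteq> closure ?T" by (rule closure_minimal) simp
  moreover have "closure {0<..<1} = {0..1::real}" by simp
  ultimately show ?thesis by (simp only:)
qed

theorem theorem5p1:
  assumes "CARD('n::finite) \<ge> 3"
  shows "support_dims TYPE('n) \<subseteq> {ereal (real CARD('n) - 1)..ereal (real CARD('n))} \<and>
         {ereal (real CARD('n) - 1)..ereal (real CARD('n))} \<subseteq> closure (support_dims TYPE('n))"
proof
  have d: "2 \<le> CARD('n)" using assms by simp
  have "hausdorff_dim (supp \<mu>) \<in> {ereal (real CARD('n) - 1)..ereal (real CARD('n))}"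
    if "\<mu> \<in> stochastic_uniform_marginals" for \<mu> :: "(real ^ 'n) measure"
  proof -
    have "sets \<mu> = sets borel_cube"
      using that by (simp add: stochastic_uniform_marginals_def stochastic_measure_def)
    then show ?thesis using dim_supp_ge[OF d that] dim_supp_le by auto
  qed
  then show "support_dims TYPE('n) \<subseteq> {ereal (real CARD('n) - 1)..ereal (real CARD('n))}"
    unfolding support_dims_def by blast
  define f where "f t = ereal (real CARD('n) - 1 + t)" for t
  let ?T = "{real p / real q | p q. 0 < p \<and> p < q}"
  have "f s \<in> support_dims TYPE('n)" if sT: "s \<in> ?T" for s
  proof -
    obtain p q where s: "s = real p / real q" "0 < p" "p < q" using sT by blast
    \<comment> \<open>with powers of \<open>2\<close> as bases the exponent \<open>log N m\<close> is the given fraction\<close>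
    have m: "2 \<le> (2::nat) ^ p" "(2::nat) ^ p < 2 ^ q"
      using s(2,3) self_le_power[of "2::nat" p] by auto
    have "log (2 ^ q) (2 ^ p) = s"
      using s by (simp add: log_def ln_realpow)
    then have "f s = hausdorff_dim (supp (twisted_measure (undefined :: 'n) (spread (2 ^ p) (2 ^ q))))"
      using dim_supp_twisted_spread[OF d m, of undefined] by (simp add: f_def)
    then show ?thesis
      unfolding support_dims_def
      using twisted_measure_uniform_marginals[OF d spread_measurable] by blast
  qed
  then have "closure (f ` ?T) \<subseteq> closure (support_dims TYPE('n))"
    by (intro closure_mono) blast
  moreover have "f ` closure ?T \<subseteq> closure (f ` ?T)"
    unfolding f_def by (intro continuous_image_closure_subset[of UNIV]) (auto intro!: continuous_intros)
  moreover have "{ereal (real CARD('n) - 1)..ereal (real CARD('n))} \<subseteq> f ` {0..1}"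
  proof
    fix x assume x: "x \<in> {ereal (real CARD('n) - 1)..ereal (real CARD('n))}"
    then obtain y where y: "x = ereal y" by (cases x) auto
    then show "x \<in> f ` {0..1}"
      using x by (intro image_eqI[of _ _ "y - (real CARD('n) - 1)"]) (auto simp: f_def)
  qed
  ultimately show "{ereal (real CARD('n) - 1)..ereal (real CARD('n))} \<subseteq> closure (support_dims TYPE('n))"
    using image_mono[OF unit_interval_subset_closure_fractions, of f] by blast
qed

end
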